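(* For every integer $d\ge 2$, the Pythagoras number $p(3,2d)$ of ternary forms of degree $2d$ is either $d+1$ or $d+2$, i.e. $p(3,2d)\in\{d+1,\,d+2\}$.
   Context: For $n\ge1$, $e\ge0$ let $\mathbb{R}[\mathtt{x}]_e$ denote the space of forms (homogeneous polynomials) of degree $e$ in $\mathbb{R}[x_1,\dots,x_n]$. Let $\Sigma_{n,2d}\subseteq\mathbb{R}[\mathtt{x}]_{2d}$ be the set of forms of degree $2d$ that are finite sums of squares of forms in $\mathbb{R}[\mathtt{x}]_d$. For $f\in\Sigma_{n,2d}$ the sos length $\ell(f)$ is the smallest $r\ge0$ such that $f=p_1^2+\cdots+p_r^2$ for some $p_1,\dots,p_r\in\mathbb{R}[\mathtt{x}]_d$. The Pythagoras number is $p(n,2d)=\sup\{\ell(f)\colon f\in\Sigma_{n,2d}\}$. *)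

theory Defs
  imports Complex_Main "HOL-Library.Poly_Mapping" "HOL-Library.Extended_Nat"
begin

text \<open>
  Real polynomials are finitely supported maps from exponent vectors to coefficients; the ring
  structure is the one from \<^theory>\<open>HOL-Library.Poly_Mapping\<close> (convolution product). The variables
  \<open>x\<^sub>1, \<dots>, x\<^sub>n\<close> are represented by the indices \<open>0, \<dots>, n - 1\<close>.
\<close>

type_synonym monomial = "nat \<Rightarrow>\<^sub>0 nat"
type_synonym real_mpoly = "monomial \<Rightarrow>\<^sub>0 real"

definition monomial_degree :: "monomial \<Rightarrow> nat" where
  "monomial_degree m = (\<Sum>i\<in>Poly_Mapping.keys m. Poly_Mapping.lookup m i)"

text \<open>The zero polynomial is a form of every degree.\<close>

definition forms :: "nat \<Rightarrow> nat \<Rightarrow> real_mpoly set" where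
  "forms n e = {p. \<forall>m\<in>Poly_Mapping.keys p.
     Poly_Mapping.keys m \<subseteq> {..<n} \<and> monomial_degree m = e}"

definition is_sum_of_squares :: "nat \<Rightarrow> nat \<Rightarrow> nat \<Rightarrow> real_mpoly \<Rightarrow> bool" where
  "is_sum_of_squares n d r f \<longleftrightarrow>
     (\<exists>p :: nat \<Rightarrow> real_mpoly. (\<forall>i<r. p i \<in> forms n d) \<and> f = (\<Sum>i<r. (p i)\<^sup>2))"

text \<open>
  The second argument of the following three constants is half the degree:
  \<open>sos_forms n d\<close> is \<open>\<Sigma>\<^bsub>n,2d\<^esub>\<close> and \<open>pythagoras_number n d\<close> is \<open>p(n,2d)\<close>.
\<close>

definition sos_forms :: "nat \<Rightarrow> nat \<Rightarrow> real_mpoly set" where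
  "sos_forms n d = {f \<in> forms n (2 * d). \<exists>r. is_sum_of_squares n d r f}"

definition sos_length :: "nat \<Rightarrow> nat \<Rightarrow> real_mpoly \<Rightarrow> nat" where
  "sos_length n d f = (LEAST r. is_sum_of_squares n d r f)"

text \<open>The supremum is taken in \<^typ>\<open>enat\<close>, so that it is \<open>\<infinity>\<close> if the lengths are unbounded.\<close>

definition pythagoras_number :: "nat \<Rightarrow> nat \<Rightarrow> enat" where
  "pythagoras_number n d = (SUP f\<in>sos_forms n d. enat (sos_length n d f))"

end

theory Submission
  imports Defs "HOL-Computational_Algebra.Fundamental_Theorem_Algebra"
begin

text \<open>
  Upper bound. Dehomogenizing and collecting powers of the second variable turns a sum of \<open>N\<close>
  squares of ternary forms of degree \<open>d\<close> into \<open>d + 1\<close> vectors in \<open>\<real>[x]\<^sup>N\<close>, and only their Gram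
  matrix matters. If \<open>N \<ge> d + 3\<close>, two orthogonal vectors \<open>u, v\<close> are orthogonal to all of them. Every
  conic \<open>Z\<^sup>2 = a X\<^sup>2 + b Y\<^sup>2\<close> with \<open>a, b\<close> nonnegative has a point over \<open>\<real>(x)\<close>, so some combination
  \<open>c\<close> of \<open>u, v\<close> has a square as its norm. A descent by reflections, in the style of Cassels, makes
  \<open>c\<close> constant while the given vectors stay polynomial; rotating \<open>c\<close> to a unit vector then saves one
  square.

  Lower bound. Take \<open>d + 1\<close> lines in general position and let \<open>f\<close> be the sum of the squares of the
  \<open>d + 1\<close> products of \<open>d\<close> of the lines. In any representation of \<open>f\<close>, each summand vanishes at the
  pairwise intersections of the lines and hence is a combination of these products. As their
  pairwise products are linearly independent, the Gram matrix of \<open>f\<close> is unique and has rank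
  \<open>d + 1\<close>.
\<close>

section \<open>Linear systems over an integral domain\<close>

text \<open>Fraction-free elimination: the pivot row \<open>e\<close> and column \<open>p\<close>
  replace the other entries by 2 x 2 minors, so no division occurs and the lemma serves real numbers
  and real polynomials alike.\<close>

lemma homogeneous_system_nontrivial_solution:
  fixes A :: "'e \<Rightarrow> 'v \<Rightarrow> 'a::idom"
  assumes "finite E" "finite V" "card E < card V"
  shows "\<exists>x. (\<exists>j\<in>V. x j \<noteq> 0) \<and> (\<forall>i\<in>E. (\<Sum>j\<in>V. A i j * x j) = 0)"
  using assms
proof (induction E arbitrary: V A rule: finite_induct)
  case empty
  then obtain j where "j \<in> V" by (metis all_not_in_conv card.empty less_numeral_extra(3))
  then show ?case by (intro exI[of _ "\<lambda>_. 1"]) auto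
next
  case (insert e E)
  show ?case
  proof (cases "\<forall>j\<in>V. A e j = 0")
    case True
    have "card E < card V" using insert by simp
    then obtain x where "\<exists>j\<in>V. x j \<noteq> 0" "\<forall>i\<in>E. (\<Sum>j\<in>V. A i j * x j) = 0"
      using insert.IH[OF insert.prems(1), of A] by blast
    with True show ?thesis by (intro exI[of _ x]) auto
  next
    case False
    then obtain p where p: "p \<in> V" "A e p \<noteq> 0" by auto
    define V' where "V' = V - {p}"
    have V': "finite V'" "p \<notin> V'" "V = insert p V'" using p insert.prems by (auto simp: V'_def)
    have "card E < card V'" using insert.prems insert.hyps V'(1,2) by (simp add: V'(3))
    then obtain x where x: "\<exists>j\<in>V'. x j \<noteq> 0"
      "\<forall>i\<in>E. (\<Sum>j\<in>V'. (A e p * A i j - A i p * A e j) * x j) = 0"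
      using insert.IH[OF V'(1), of "\<lambda>i j. A e p * A i j - A i p * A e j"] by blast
    \<comment> \<open>Back substitution, multiplied through by the pivot
      \<open>A e p\<close>.\<close>
    define y where "y j = (if j = p then - (\<Sum>j\<in>V'. A e j * x j) else A e p * x j)" for j
    have sum_y: "(\<Sum>j\<in>V. A i j * y j)
        = A e p * (\<Sum>j\<in>V'. A i j * x j) - A i p * (\<Sum>j\<in>V'. A e j * x j)" for i
    proof -
      have "(\<Sum>j\<in>V'. A i j * y j) = A e p * (\<Sum>j\<in>V'. A i j * x j)"
        unfolding sum_distrib_left using V' by (intro sum.cong) (auto simp: y_def)
      then show ?thesis using V' by (simp add: y_def)
    qed
    have "\<forall>i\<in>E. (\<Sum>j\<in>V. A i j * y j) = 0"
      using x(2) unfolding sum_y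
      by (simp add: left_diff_distrib sum_subtractf sum_distrib_left mult.assoc)
    moreover have "(\<Sum>j\<in>V. A e j * y j) = 0" unfolding sum_y by (simp add: mult.commute)
    moreover have "\<exists>j\<in>V. y j \<noteq> 0" using x(1) V' p by (auto simp: y_def)
    ultimately show ?thesis by (intro exI[of _ y]) auto
  qed
qed

subsection \<open>Gram matrices over the univariate polynomials\<close>

definition dot :: "'i set \<Rightarrow> ('i \<Rightarrow> 'a::comm_ring_1) \<Rightarrow> ('i \<Rightarrow> 'a) \<Rightarrow> 'a" where
  "dot I v w = (\<Sum>i\<in>I. v i * w i)"

lemma dot_commute: "dot I v w = dot I w v"
  by (simp add: dot_def mult.commute)

lemma dot_cong: "(\<And>i. i \<in> I \<Longrightarrow> v i = v' i) \<Longrightarrow> (\<And>i. i \<in> I \<Longrightarrow> w i = w' i) \<Longrightarrow> dot I v w = dot I v' w'"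
  by (simp add: dot_def)

lemma dot_add_right: "dot I v (\<lambda>i. w i + u i) = dot I v w + dot I v u"
  by (simp add: dot_def algebra_simps sum.distrib)

lemma dot_diff_right: "dot I v (\<lambda>i. w i - u i) = dot I v w - dot I v u"
  by (simp add: dot_def algebra_simps sum_subtractf)

lemma dot_scale_right: "dot I v (\<lambda>i. g * w i) = g * dot I v w"
  by (simp add: dot_def sum_distrib_left mult.left_commute)

lemma dot_add_left: "dot I (\<lambda>i. w i + u i) v = dot I w v + dot I u v"
  by (simp add: dot_def algebra_simps sum.distrib)

lemma dot_diff_left: "dot I (\<lambda>i. w i - u i) v = dot I w v - dot I u v"
  by (simp add: dot_def algebra_simps sum_subtractf)

lemma dot_scale_left: "dot I (\<lambda>i. g * w i) v = g * dot I w v"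
  by (simp add: dot_def sum_distrib_left mult.assoc)

lemmas dot_bilinear = dot_add_right dot_diff_right dot_scale_right
  dot_add_left dot_diff_left dot_scale_left

text \<open>For \<open>g = 2 (v, t) / (t, t)\<close>, \<open>v - g t\<close> is the reflection of
  \<open>v\<close> in \<open>t\<close>. The denominator is multiplied out, so each use has to show
  that the quotient exists in the ring.\<close>

lemma dot_reflection:
  fixes v w t :: "'i \<Rightarrow> 'a::{idom,ring_char_0}"
  assumes "g * dot I t t = 2 * dot I v t" "h * dot I t t = 2 * dot I w t"
  shows "dot I (\<lambda>i. v i - g * t i) (\<lambda>i. w i - h * t i) = dot I v w"
proof -
  have "2 * dot I (\<lambda>i. v i - g * t i) (\<lambda>i. w i - h * t i)
      = 2 * dot I v w - h * (2 * dot I v t) - g * (2 * dot I w t) + 2 * g * h * dot I t t"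
    by (simp add: dot_bilinear algebra_simps dot_commute[of I t v] dot_commute[of I t w])
  also have "\<dots> = 2 * dot I v w"
    unfolding assms[symmetric] by (simp add: algebra_simps)
  finally show ?thesis by simp
qed

lemma poly_dot: "poly (dot I v w) x = (\<Sum>i\<in>I. poly (v i) x * poly (w i) x)"
  by (simp add: dot_def poly_sum)

lemma dot_self_eq_0_iff:
  fixes v :: "'i \<Rightarrow> real poly"
  assumes "finite I"
  shows "dot I v v = 0 \<longleftrightarrow> (\<forall>i\<in>I. v i = 0)"
proof
  assume "dot I v v = 0"
  then have "(\<Sum>i\<in>I. (poly (v i) x)\<^sup>2) = 0" for x
    using poly_dot[of I v v x] by (simp add: power2_eq_square)
  then have "poly (v i) x = 0" if "i \<in> I" for i x
    using assms that by (simp add: sum_nonneg_eq_0_iff)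
  then show "\<forall>i\<in>I. v i = 0" by (metis poly_all_0_iff_0)
qed (simp add: dot_def)

text \<open>At twice the maximal degree \<open>D\<close> the coefficient of the sum is a sum of real
  squares, not all zero, so the top terms cannot cancel.\<close>

lemma degree_sum_of_squares:
  fixes v :: "'i \<Rightarrow> real poly"
  assumes "finite I" "i \<in> I" "degree (\<Sum>i\<in>I. (v i)\<^sup>2) \<le> 2 * n"
  shows "degree (v i) \<le> n"
proof (rule ccontr)
  assume "\<not> degree (v i) \<le> n"
  define D where "D = Max ((\<lambda>i. degree (v i)) ` I)"
  have D: "degree (v j) \<le> D" if "j \<in> I" for j using that assms by (simp add: D_def)
  have "D > n" using D[OF assms(2)] \<open>\<not> degree (v i) \<le> n\<close> by simp
  have "D \<in> (\<lambda>i. degree (v i)) ` I" unfolding D_def using assms by (intro Max_in) auto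
  then obtain j where j: "j \<in> I" "degree (v j) = D" by auto
  have "coeff ((v k)\<^sup>2) (D + D) = (coeff (v k) D)\<^sup>2" if "k \<in> I" for k
  proof (cases "degree (v k) = D")
    case True
    then show ?thesis by (metis coeff_mult_degree_sum power2_eq_square)
  next
    case False
    then have "degree (v k) < D" using D[OF that] by simp
    moreover from this have "degree ((v k)\<^sup>2) < D + D"
      using degree_power_le[of "v k" 2] by simp
    ultimately show ?thesis by (simp add: coeff_eq_0)
  qed
  then have "coeff (\<Sum>i\<in>I. (v i)\<^sup>2) (D + D) = (\<Sum>k\<in>I. (coeff (v k) D)\<^sup>2)"
    by (simp add: coeff_sum)
  moreover have "coeff (\<Sum>i\<in>I. (v i)\<^sup>2) (D + D) = 0"
    using assms(3) \<open>D > n\<close> by (intro coeff_eq_0) auto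
  ultimately have "coeff (v j) D = 0"
    using j assms(1) by (simp add: sum_nonneg_eq_0_iff)
  then show False using j \<open>D > n\<close> by (metis degree_0 gr_implies_not0 leading_coeff_0_iff)
qed

section \<open>Low-degree factors of real polynomials\<close>

text \<open>The quadratic is \<open>(X - z) (X - conj z)\<close>. The remainder modulo it is a real
  \<open>a + b X\<close> vanishing at the nonreal \<open>z\<close>, which forces
  \<open>a = b = 0\<close>.\<close>

lemma real_poly_quadratic_factor:
  fixes p :: "real poly" and z :: complex
  assumes "poly (map_poly of_real p) z = 0" "Im z \<noteq> 0"
  shows "[:(Re z)\<^sup>2 + (Im z)\<^sup>2, - 2 * Re z, 1:] dvd p"
proof -
  define m where "m = [:(Re z)\<^sup>2 + (Im z)\<^sup>2, - 2 * Re z, 1:]"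
  let ?C = "map_poly complex_of_real"
  have [simp]: "?C (a * b) = ?C a * ?C b" "?C (a + b) = ?C a + ?C b" for a b
    by (intro poly_eqI; simp add: coeff_map_poly coeff_mult)+
  have "degree (p mod m) < 2" using degree_mod_less[of m p] by (auto simp: m_def)
  then have "p mod m = [:coeff (p mod m) 0, coeff (p mod m) 1:]"
    by (intro poly_eqI) (auto simp: coeff_pCons coeff_eq_0 split: nat.split)
  then obtain a b where ab: "p mod m = [:a, b:]" by blast
  have "poly (?C m) z = 0"
    by (simp add: m_def map_poly_pCons complex_eq_iff power2_eq_square algebra_simps)
  moreover have "?C p = ?C (p div m) * ?C m + ?C (p mod m)"
    by (metis div_mult_mod_eq \<open>\<And>b a. ?C (a * b) = ?C a * ?C b\<close> \<open>\<And>b a. ?C (a + b) = ?C a + ?C b\<close>)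
  ultimately have "poly (?C (p mod m)) z = 0" using assms(1) by simp
  then have "a = 0 \<and> b = 0" using assms(2)
    unfolding ab by (auto simp: map_poly_pCons complex_eq_iff)
  then show ?thesis using ab by (simp add: m_def dvd_eq_mod_eq_0)
qed

lemma real_poly_factor_cases:
  fixes p :: "real poly"
  assumes "degree p > 0"
  obtains (linear) r where "[:- r, 1:] dvd p"
    | (quadratic) a b where "b \<noteq> 0" "[:a\<^sup>2 + b\<^sup>2, - 2 * a, 1:] dvd p"
proof -
  have "\<not> constant (poly (map_poly complex_of_real p))"
    using assms by (simp add: constant_degree degree_map_poly)
  then obtain z where z: "poly (map_poly complex_of_real p) z = 0"
    using fundamental_theorem_of_algebra by blast
  show thesis
  proof (cases "Im z = 0")
    case True
    then have "z = of_real (Re z)" by (simp add: complex_eq_iff)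
    moreover have "poly (map_poly complex_of_real p) (of_real (Re z)) = of_real (poly p (Re z))"
      by (induction p) (auto simp: map_poly_pCons)
    ultimately have "poly p (Re z) = 0" using z by simp
    then show thesis using linear by (simp add: poly_eq_0_iff_dvd)
  next
    case False
    then show thesis using quadratic real_poly_quadratic_factor[OF z] by blast
  qed
qed

text \<open>
  For a factor \<open>p\<close> of \<open>s\<close> of degree at most 2 and \<open>t = c mod p\<close>, the norm of \<open>t\<close> is a constant
  multiple of \<open>p\<close>. If this constant is not 0, the reflection in \<open>t\<close> preserves integrality of the
  vectors orthogonal to \<open>c\<close> (they are orthogonal to \<open>t\<close> modulo \<open>p\<close>) and makes \<open>c\<close> divisible by \<open>p\<close>,
  because the norm of \<open>c\<close> is divisible by \<open>p\<^sup>2\<close>. If it is 0, then \<open>c\<close> is divisible by \<open>p\<close> already.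
\<close>

lemma descend_to_constant_vector:
  fixes q :: "'k \<Rightarrow> 'i \<Rightarrow> real poly" and c :: "'i \<Rightarrow> real poly"
  assumes "finite I" "s \<noteq> 0" "dot I c c = s\<^sup>2" "\<forall>k\<in>K. dot I (q k) c = 0"
  shows "\<exists>q' c0. (\<forall>k\<in>K. \<forall>l\<in>K. dot I (q' k) (q' l) = dot I (q k) (q l))
    \<and> (\<exists>i\<in>I. c0 i \<noteq> 0) \<and> (\<forall>k\<in>K. dot I (q' k) (\<lambda>i. [:c0 i:]) = 0)"
  using assms(2-4)
proof (induction "degree s" arbitrary: s c q rule: less_induct)
  case less
  show ?case
  proof (cases "degree s = 0")
    case True
    have "degree (c i) = 0" if "i \<in> I" for i
      using degree_sum_of_squares[OF \<open>finite I\<close> that, of c 0] less.prems True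
      by (simp add: dot_def power2_eq_square degree_mult_eq)
    then have c: "c i = [:coeff (c i) 0:]" if "i \<in> I" for i
      using that by (metis coeff_pCons_0 degree_eq_zeroE)
    have "\<exists>i\<in>I. coeff (c i) 0 \<noteq> 0"
    proof (rule ccontr)
      assume "\<not> (\<exists>i\<in>I. coeff (c i) 0 \<noteq> 0)"
      then have "dot I c c = 0" using c by (auto simp: dot_def intro!: sum.neutral)
      then show False using less.prems by simp
    qed
    moreover have "dot I (q k) (\<lambda>i. [:coeff (c i) 0:]) = dot I (q k) c" for k
      by (rule dot_cong) (simp_all add: c[symmetric])
    ultimately show ?thesis
      using less.prems(3) by (intro exI[of _ q] exI[of _ "\<lambda>i. coeff (c i) 0"]) simp
  next
    case False
    then have "degree s > 0" by simp
    then obtain p where p: "p dvd s" "0 < degree p" "degree p \<le> 2"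
    proof (cases rule: real_poly_factor_cases)
      case (linear r)
      then show ?thesis using that[of "[:- r, 1:]"] by simp
    next
      case (quadratic a b)
      then show ?thesis using that[of "[:a\<^sup>2 + b\<^sup>2, - 2 * a, 1:]"] by simp
    qed
    have "p \<noteq> 0" using p by auto
    from p(1) obtain s' where s': "s = p * s'" by (elim dvdE)
    have "s' \<noteq> 0" using s' less.prems by auto
    have deg: "degree s' < degree s"
      using p(2) \<open>p \<noteq> 0\<close> \<open>s' \<noteq> 0\<close> by (simp add: s' degree_mult_eq)
    define t where "t i = c i mod p" for i
    define e where "e i = c i div p" for i
    have c: "c = (\<lambda>i. t i + p * e i)" by (simp add: t_def e_def fun_eq_iff)
    \<comment> \<open>Expanding \<open>(c, c) = s^2\<close> along \<open>c = t + p e\<close>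
      exhibits \<open>p\<close> as a divisor of \<open>(t, t)\<close>.\<close>
    have norm_c: "dot I t t + 2 * p * dot I t e + p\<^sup>2 * dot I e e = p\<^sup>2 * s'\<^sup>2"
      using less.prems(2) unfolding c s'
      by (simp add: dot_bilinear dot_commute[of I e t] power2_eq_square algebra_simps)
    have orth: "dot I (q k) t = - p * dot I (q k) e" if "k \<in> K" for k
      using less.prems(3) that unfolding c
      by (simp add: dot_bilinear) (simp add: add_eq_0_iff)
    show ?thesis
    proof (cases "dot I t t = 0")
      case True
      then have t: "\<forall>i\<in>I. t i = 0" using dot_self_eq_0_iff \<open>finite I\<close> by blast
      then have "dot I t e = 0" by (simp add: dot_def)
      then have "dot I e e = s'\<^sup>2" using norm_c True \<open>p \<noteq> 0\<close> by simp
      moreover have "\<forall>k\<in>K. dot I (q k) e = 0"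
        using orth t \<open>p \<noteq> 0\<close> by (simp add: dot_def)
      ultimately show ?thesis using less.hyps[OF deg \<open>s' \<noteq> 0\<close>] by blast
    next
      case False
      define \<kappa> where "\<kappa> = p * (s'\<^sup>2 - dot I e e) - 2 * dot I t e"
      define m where "m = s'\<^sup>2 - dot I e e"
      have \<kappa>: "\<kappa> = p * m - 2 * dot I t e" by (simp add: \<kappa>_def m_def)
      have T: "dot I t t = p * \<kappa>"
        using norm_c by (simp add: \<kappa>_def power2_eq_square algebra_simps)
      have "\<kappa> \<noteq> 0" using T False by auto
      \<comment> \<open>Since \<open>(t, t) = p \<kappa>\<close> has degree at most
        \<open>2 deg p - 2\<close> and \<open>deg p\<close> is at most 2, the cofactor
        \<open>\<kappa>\<close> is constant.\<close>
      have deg_t: "degree (t i) \<le> degree p - 1" for i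
        using degree_mod_less[OF \<open>p \<noteq> 0\<close>, of "c i"] p(2) by (auto simp: t_def)
      have "degree (t i * t i) \<le> 2 * (degree p - 1)" for i
        using degree_mult_le[of "t i" "t i"] deg_t[of i] by linarith
      then have "degree (dot I t t) \<le> 2 * (degree p - 1)"
        unfolding dot_def by (intro degree_sum_le \<open>finite I\<close>) simp
      then have "degree \<kappa> = 0"
        using p \<open>p \<noteq> 0\<close> \<open>\<kappa> \<noteq> 0\<close> unfolding T by (simp add: degree_mult_eq)
      then obtain k where k: "\<kappa> = [:k:]" by (elim degree_eq_zeroE)
      with \<open>\<kappa> \<noteq> 0\<close> have "k \<noteq> 0" by simp
      define k' where "k' = [:1 / k:]"
      have kk': "\<kappa> * k' = 1" using \<open>k \<noteq> 0\<close> by (simp add: k k'_def)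
      \<comment> \<open>The coefficient \<open>2 (q j, t) / (t, t)\<close>: \<open>p\<close> cancels
        by \<open>orth\<close> and \<open>T\<close>, leaving only the unit \<open>\<kappa>\<close>
        with inverse \<open>k'\<close> to divide by.\<close>
      define g where "g j = - 2 * k' * dot I (q j) e" for j
      define q' where "q' j = (\<lambda>i. q j i - g j * t i)" for j
      \<comment> \<open>Likewise \<open>2 (c, t) / (t, t) = 2 + 2 (t, e) / \<kappa>\<close>, which
        is \<open>1 + p m k'\<close> because \<open>2 (t, e) = p m - \<kappa>\<close>. Subtracting
        \<open>h t\<close> from \<open>t + p e\<close> then leaves \<open>p c'\<close>.\<close>
      define h where "h = 1 + p * m * k'"
      define c' where "c' i = e i - m * k' * t i" for i
      have g: "g j * dot I t t = 2 * dot I (q j) t" if "j \<in> K" for j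
      proof -
        have "g j * dot I t t = - 2 * p * dot I (q j) e * (\<kappa> * k')"
          unfolding g_def T by (simp add: algebra_simps)
        then show ?thesis unfolding kk' orth[OF that] by simp
      qed
      have h: "h * dot I t t = 2 * dot I c t"
      proof -
        have "h * dot I t t = p * \<kappa> + p * p * m * (\<kappa> * k')"
          unfolding h_def T by (simp add: algebra_simps)
        also have "\<dots> = 2 * (p * \<kappa> + p * dot I t e)"
          unfolding kk' by (simp add: \<kappa> algebra_simps)
        also have "\<dots> = 2 * dot I c t"
          unfolding c dot_bilinear T dot_commute[of I e t] by simp
        finally show ?thesis .
      qed
      have c': "(\<lambda>i. c i - h * t i) = (\<lambda>i. p * c' i)"
        by (simp add: fun_eq_iff c h_def c'_def algebra_simps)
      have "p * (p * dot I c' c') = dot I (\<lambda>i. c i - h * t i) (\<lambda>i. c i - h * t i)"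
        unfolding c' dot_bilinear ..
      also have "\<dots> = p * (p * s'\<^sup>2)"
        unfolding dot_reflection[OF h h] less.prems(2) s' by (simp add: power2_eq_square)
      finally have norm_c': "dot I c' c' = s'\<^sup>2" using \<open>p \<noteq> 0\<close> by simp
      have orth_c': "\<forall>j\<in>K. dot I (q' j) c' = 0"
      proof
        fix j assume j: "j \<in> K"
        have "p * dot I (q' j) c' = dot I (\<lambda>i. q j i - g j * t i) (\<lambda>i. c i - h * t i)"
          unfolding c' dot_scale_right by (simp add: q'_def)
        also have "\<dots> = 0"
          unfolding dot_reflection[OF g[OF j] h] using less.prems(3) j by blast
        finally show "dot I (q' j) c' = 0" using \<open>p \<noteq> 0\<close> by simp
      qed
      obtain q'' c0 where
        "\<forall>k\<in>K. \<forall>l\<in>K. dot I (q'' k) (q'' l) = dot I (q' k) (q' l)"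
        "\<exists>i\<in>I. c0 i \<noteq> 0" "\<forall>k\<in>K. dot I (q'' k) (\<lambda>i. [:c0 i:]) = 0"
        using less.hyps[OF deg \<open>s' \<noteq> 0\<close> norm_c' orth_c'] by blast
      moreover have "dot I (q' k) (q' l) = dot I (q k) (q l)" if "k \<in> K" "l \<in> K" for k l
        unfolding q'_def by (rule dot_reflection[OF g[OF that(1)] g[OF that(2)]])
      ultimately show ?thesis by (intro exI[of _ q''] exI[of _ c0]) simp
    qed
  qed
qed

text \<open>The reflection exchanging \<open>c\<close> with the vector \<open>u\<close> of equal
  norm on the axis of \<open>i\<^sub>0\<close> carries the complement of \<open>c\<close> to the
  vectors with coordinate \<open>i\<^sub>0\<close> equal to 0.\<close>

lemma eliminate_coordinate:
  fixes q :: "'k \<Rightarrow> 'i \<Rightarrow> real poly" and c :: "'i \<Rightarrow> real"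
  assumes "finite I" "i\<^sub>0 \<in> I" "\<exists>i\<in>I. c i \<noteq> 0" "\<forall>k\<in>K. dot I (q k) (\<lambda>i. [:c i:]) = 0"
  shows "\<exists>q'. (\<forall>k\<in>K. \<forall>l\<in>K. dot I (q' k) (q' l) = dot I (q k) (q l)) \<and> (\<forall>k\<in>K. q' k i\<^sub>0 = 0)"
proof -
  define S where "S = (\<Sum>i\<in>I. (c i)\<^sup>2)"
  have "S > 0" unfolding S_def using assms(1,3) by (auto intro: sum_pos2)
  \<comment> \<open>Of the two roots of \<open>S\<close>, one differs from
    \<open>c i\<^sub>0\<close>; this makes the norm \<open>n\<close> of the mirror vector
    \<open>w = c - u\<close> nonzero.\<close>
  then obtain r where r: "r\<^sup>2 = S" "r \<noteq> c i\<^sub>0" "r \<noteq> 0"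
    by (metis power2_minus real_sqrt_pow2 less_imp_le zero_power2 less_irrefl equal_neg_zero)
  define n where "n = 2 * r * (r - c i\<^sub>0)"
  have "n \<noteq> 0" using r by (simp add: n_def)
  define u :: "'i \<Rightarrow> real poly" where "u i = (if i = i\<^sub>0 then [:r:] else 0)" for i
  define w where "w i = [:c i:] - u i" for i
  have dot_u: "dot I v u = [:r:] * v i\<^sub>0" for v
    using assms(1,2) by (simp add: dot_def u_def if_distrib sum.delta' cong: if_cong)
  have "dot I (\<lambda>i. [:c i:]) (\<lambda>i. [:c i:]) = [:S:]"
    unfolding dot_def S_def
    by (rule poly_ext) (simp add: poly_sum power2_eq_square)
  then have ww: "dot I w w = [:n:]"
    unfolding w_def dot_bilinear dot_u dot_commute[of I u] n_def
    by (simp add: u_def r(1)[symmetric] power2_eq_square algebra_simps)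
  define g where "g k = [:- 2 * r / n:] * q k i\<^sub>0" for k
  define q' where "q' k = (\<lambda>i. q k i - g k * w i)" for k
  have g: "g k * dot I w w = 2 * dot I (q k) w" if "k \<in> K" for k
  proof -
    have "2 * dot I (q k) w = [:- 2 * r:] * q k i\<^sub>0"
      using assms(4) that unfolding w_def dot_bilinear dot_u
      by (simp add: algebra_simps) (rule poly_ext, simp)
    then show ?thesis using \<open>n \<noteq> 0\<close> unfolding g_def ww by (simp add: mult.commute)
  qed
  have q'_0: "q' k i\<^sub>0 = 0" for k
  proof -
    have "[:- 2 * r / n:] * w i\<^sub>0 = 1"
      using \<open>n \<noteq> 0\<close> by (simp add: w_def u_def n_def one_pCons field_simps)
    then have "g k * w i\<^sub>0 = q k i\<^sub>0" unfolding g_def by (metis mult.assoc mult.commute mult_1)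
    then show ?thesis by (simp add: q'_def)
  qed
  have "dot I (q' k) (q' l) = dot I (q k) (q l)" if "k \<in> K" "l \<in> K" for k l
    unfolding q'_def by (rule dot_reflection[OF g[OF that(1)] g[OF that(2)]])
  with q'_0 show ?thesis by blast
qed

subsection \<open>Conics over the univariate polynomials\<close>

text \<open>Over the fraction field this says that \<open>b\<close> is a value of the norm form
  \<open>z^2 - a x^2\<close>. Requiring \<open>Y\<close> nonzero is what permits the division by
  \<open>Y\<close> and makes the property multiplicative in \<open>b\<close>.\<close>

definition conic_solvable :: "'a::idom \<Rightarrow> 'a \<Rightarrow> bool" where
  "conic_solvable a b \<longleftrightarrow> (\<exists>X Y Z. Y \<noteq> 0 \<and> Z\<^sup>2 = a * X\<^sup>2 + b * Y\<^sup>2)"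

lemma conic_solvableI: "Y \<noteq> 0 \<Longrightarrow> Z\<^sup>2 = a * X\<^sup>2 + b * Y\<^sup>2 \<Longrightarrow> conic_solvable a b"
  unfolding conic_solvable_def by blast

lemma conic_solvable_square: "conic_solvable a (b\<^sup>2)"
  by (rule conic_solvableI[of 1 b _ 0]) auto

text \<open>Brahmagupta's identity, that is, multiplicativity of the norm.\<close>

lemma conic_solvable_mult:
  assumes "conic_solvable a b" "conic_solvable a b'"
  shows "conic_solvable a (b * b')"
proof -
  from assms obtain X Y Z X' Y' Z' where
    Y: "Y \<noteq> 0" "Y' \<noteq> 0" and eq: "Z\<^sup>2 = a * X\<^sup>2 + b * Y\<^sup>2" "Z'\<^sup>2 = a * X'\<^sup>2 + b' * Y'\<^sup>2"
    unfolding conic_solvable_def by blast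
  have "(Z * Z' + a * X * X')\<^sup>2 - a * (Z * X' + Z' * X)\<^sup>2 = (Z\<^sup>2 - a * X\<^sup>2) * (Z'\<^sup>2 - a * X'\<^sup>2)"
    by (simp add: power2_eq_square algebra_simps)
  also have "\<dots> = b * b' * (Y * Y')\<^sup>2" unfolding eq by (simp add: power2_eq_square algebra_simps)
  finally show ?thesis
    using Y by (intro conic_solvableI[of "Y * Y'" "Z * Z' + a * X * X'" a "Z * X' + Z' * X"])
      (auto simp: algebra_simps)
qed

lemma conic_solvable_cancel_square:
  assumes "conic_solvable a (b * c\<^sup>2)" "c \<noteq> 0"
  shows "conic_solvable a b"
proof -
  from assms(1) obtain X Y Z where "Y \<noteq> 0" "Z\<^sup>2 = a * X\<^sup>2 + b * c\<^sup>2 * Y\<^sup>2"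
    unfolding conic_solvable_def by blast
  then show ?thesis using assms(2)
    by (intro conic_solvableI[of "c * Y" Z a X]) (auto simp: power_mult_distrib mult.assoc)
qed

lemma conic_solvable_cancel:
  assumes "conic_solvable a b" "conic_solvable a (b * b')" "b \<noteq> 0"
  shows "conic_solvable a b'"
proof (rule conic_solvable_cancel_square)
  show "conic_solvable a (b' * b\<^sup>2)"
    using conic_solvable_mult[OF assms(1,2)] by (simp add: power2_eq_square mult_ac)
qed fact

lemma conic_solvable_commute:
  fixes a b :: "'a::{idom,ring_char_0}"
  assumes "conic_solvable a b" "b \<noteq> 0"
  shows "conic_solvable b a"
proof -
  from assms obtain X Y Z where Y: "Y \<noteq> 0" and eq: "Z\<^sup>2 = a * X\<^sup>2 + b * Y\<^sup>2"
    unfolding conic_solvable_def by blast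
  show ?thesis
  proof (cases "X = 0")
    case True
    then have Z: "Z\<^sup>2 = b * Y\<^sup>2" "Z \<noteq> 0" using eq Y assms(2) by auto
    \<comment> \<open>Here \<open>b\<close> is a square up to squares, and \<open>a\<close> is
      represented through \<open>4 a = (a + 1)^2 - (a - 1)^2\<close>.\<close>
    have "(Z * (a + 1))\<^sup>2 = b * (Y * (a - 1))\<^sup>2 + a * (2 * Z)\<^sup>2"
      unfolding power_mult_distrib mult.assoc[symmetric] Z(1)[symmetric]
      by (simp add: power2_eq_square algebra_simps)
    then show ?thesis using Z by (intro conic_solvableI[of "2 * Z"]) auto
  next
    case False
    then show ?thesis using eq by (intro conic_solvableI[of X Z b Y]) (auto simp: add.commute)
  qed
qed

lemma conic_solvable_pos_const:
  fixes a :: "real poly"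
  assumes "k \<ge> 0"
  shows "conic_solvable a [:k:]"
  using conic_solvable_square[of a "[:sqrt k:]"] assms by (simp add: power2_eq_square)

text \<open>A nonnegative polynomial cannot change sign at a real root, so the root is at least
  double; a quadratic factor from a nonreal root is positive everywhere.\<close>

lemma nonneg_poly_split:
  fixes p :: "real poly"
  assumes nonneg: "\<And>x. poly p x \<ge> 0" and "degree p > 0"
  obtains (square) r p' where "p = [:- r, 1:]\<^sup>2 * p'" "\<And>x. poly p' x \<ge> 0"
  | (quadratic) a b p' where "b \<noteq> 0" "p = [:a\<^sup>2 + b\<^sup>2, - 2 * a, 1:] * p'" "\<And>x. poly p' x \<ge> 0"
  using \<open>degree p > 0\<close>
proof (cases rule: real_poly_factor_cases)
  case (linear r)
  then obtain p1 where p1: "p = [:- r, 1:] * p1" by (elim dvdE)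
  have p1_eq: "poly p x = (x - r) * poly p1 x" for x by (simp add: p1 algebra_simps)
  have lim: "((\<lambda>x. poly p1 x) \<longlongrightarrow> poly p1 r) (at r within A)" for A
    by (intro isCont_tendsto_compose[of _ "poly p1"] tendsto_ident_at) simp
  have "poly p1 x \<ge> 0" if "x > r" for x
    using nonneg[of x] that by (simp add: p1_eq zero_le_mult_iff)
  then have "poly p1 r \<ge> 0"
    by (intro tendsto_lowerbound[OF lim[of "{r<..}"]])
      (auto simp: eventually_at_filter)
  moreover have "poly p1 x \<le> 0" if "x < r" for x
    using nonneg[of x] that by (simp add: p1_eq zero_le_mult_iff)
  then have "poly p1 r \<le> 0"
    by (intro tendsto_upperbound[OF lim[of "{..<r}"]])
      (auto simp: eventually_at_filter)
  ultimately have "[:- r, 1:] dvd p1" by (simp add: poly_eq_0_iff_dvd)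
  then obtain p' where "p1 = [:- r, 1:] * p'" by (elim dvdE)
  then have p': "p = [:- r, 1:]\<^sup>2 * p'" unfolding p1 power2_eq_square mult.assoc by simp
  have pos: "poly p' x \<ge> 0" if "x \<noteq> r" for x
  proof -
    have "poly p x = (x - r)\<^sup>2 * poly p' x"
      by (simp add: p' power2_eq_square algebra_simps)
    then show ?thesis using nonneg[of x] that by (simp add: zero_le_mult_iff)
  qed
  have "((\<lambda>x. poly p' x) \<longlongrightarrow> poly p' r) (at r)"
    by (intro isCont_tendsto_compose[of _ "poly p'"] tendsto_ident_at) simp
  then have "poly p' r \<ge> 0"
    by (rule tendsto_lowerbound) (use pos in \<open>auto simp: eventually_at_filter\<close>)
  with pos have "poly p' x \<ge> 0" for x by (cases "x = r") auto
  then show thesis using square p' by blast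
next
  case (quadratic a b)
  then obtain p' where p': "p = [:a\<^sup>2 + b\<^sup>2, - 2 * a, 1:] * p'" by (elim dvdE)
  have "poly [:a\<^sup>2 + b\<^sup>2, - 2 * a, 1:] x = (x - a)\<^sup>2 + b\<^sup>2" for x
    by (simp add: power2_eq_square algebra_simps)
  moreover have "(x - a)\<^sup>2 + b\<^sup>2 > 0" for x using quadratic(1) by (simp add: sum_power2_gt_zero_iff)
  ultimately have "poly p' x \<ge> 0" for x
    using nonneg[of x] unfolding p' poly_mult by (metis zero_le_mult_iff not_less)
  then show thesis using that(2) quadratic(1) p' by blast
qed

text \<open>By multiplicativity only the positive quadratic factors matter: squares and nonnegative
  constants are always represented.\<close>

lemma conic_solvable_of_quadratics:
  fixes p :: "real poly"
  assumes quadratics: "\<And>a b. b \<noteq> 0 \<Longrightarrow> conic_solvable g [:a\<^sup>2 + b\<^sup>2, - 2 * a, 1:]"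
    and "\<And>x. poly p x \<ge> 0"
  shows "conic_solvable g p"
  using assms(2)
proof (induction "degree p" arbitrary: p rule: less_induct)
  case less
  consider "p = 0" | "degree p = 0" | "degree p > 0" "p \<noteq> 0" by blast
  then show ?case
  proof cases
    case 1
    then show ?thesis using conic_solvable_square[of g 0] by simp
  next
    case 2
    then obtain k where "p = [:k:]" by (elim degree_eq_zeroE)
    then show ?thesis using less.prems[of 0] conic_solvable_pos_const by auto
  next
    case 3
    from less.prems 3(1) show ?thesis
    proof (cases rule: nonneg_poly_split)
      case (square r p')
      then have "degree p' < degree p"
        using 3(2) by (auto simp: degree_mult_eq degree_power_eq)
      then show ?thesis
        using less.hyps square conic_solvable_mult conic_solvable_square by metis
    next
      case (quadratic a b p')
      then have "degree p' < degree p" using 3(2) by (auto simp: degree_mult_eq simp del: mult_pCons_left)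
      then show ?thesis
        using less.hyps quadratic conic_solvable_mult quadratics by metis
    qed
  qed
qed

lemma conic_solvable_uminus_one: "conic_solvable [:a\<^sup>2 + b\<^sup>2, - 2 * a, 1:] (- 1)" if "(b::real) \<noteq> 0"
  using that by (intro conic_solvableI[of "[:b:]" "[:- a, 1:]" _ 1])
    (auto simp: power2_eq_square)

text \<open>The equation \<open>l^2 = p - k q\<close> represents \<open>- k q\<close>; the sign and
  the positive constant \<open>k\<close> can be removed because they are represented too.\<close>

lemma conic_solvable_of_pencil:
  fixes p q :: "real poly"
  assumes "p = [:k:] * q + l\<^sup>2" "k > 0" "conic_solvable p (- 1)"
  shows "conic_solvable p q"
proof -
  have "conic_solvable p (- [:k:] * q)"
    using assms(1) by (intro conic_solvableI[of 1 l _ 1]) auto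
  then have "conic_solvable p ([:k:] * q)"
    using conic_solvable_mult[OF assms(3)] by fastforce
  then show ?thesis
    using conic_solvable_cancel[OF conic_solvable_pos_const] assms(2)
    by (metis less_imp_le less_irrefl pCons_eq_0_iff)
qed

text \<open>The aim is a member \<open>?p - c * ?q\<close> of the pencil that is a square, so that
  \<open>conic_solvable_of_pencil\<close> applies.\<close>

lemma conic_solvable_quadratics:
  fixes a b a' b' :: real
  assumes "b \<noteq> 0" "b' \<noteq> 0"
  shows "conic_solvable [:a\<^sup>2 + b\<^sup>2, - 2 * a, 1:] [:a'\<^sup>2 + b'\<^sup>2, - 2 * a', 1:]"
    (is "conic_solvable ?p ?q")
proof -
  \<comment> \<open>a quarter of the discriminant of \<open>?p - c * ?q\<close>; at a zero with \<open>0 < c < 1\<close> this is a square\<close>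
  define h where "h c = (a - c * a')\<^sup>2 - (1 - c) * ((a\<^sup>2 + b\<^sup>2) - c * (a'\<^sup>2 + b'\<^sup>2))" for c
  \<comment> \<open>The endpoint values are \<open>h 0 = - b^2\<close> and
    \<open>h 1 = (a - a')^2\<close>.\<close>
  have "\<exists>c\<ge>0. c \<le> 1 \<and> h c = 0"
    by (rule IVT) (auto simp: h_def intro!: continuous_intros)
  then obtain c where c: "0 \<le> c" "c \<le> 1" "h c = 0" by blast
  have "c \<noteq> 0" using c(3) assms by (auto simp: h_def)
  show ?thesis
  proof (cases "c = 1")
    case False
    define m where "m = sqrt (1 - c)"
    have m: "m * m = 1 - c" "m > 0" using c False by (auto simp: m_def)
    define l where "l = [:- (a - c * a') / m, m:]"
    have "(a - c * a')\<^sup>2 = m * m * ((a\<^sup>2 + b\<^sup>2) - c * (a'\<^sup>2 + b'\<^sup>2))"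
      using c(3) by (simp add: h_def m)
    then have "((a - c * a') / m)\<^sup>2 = (a\<^sup>2 + b\<^sup>2) - c * (a'\<^sup>2 + b'\<^sup>2)"
      using m(2) by (simp add: power_divide power2_eq_square)
    moreover have "l\<^sup>2 = [:((a - c * a') / m)\<^sup>2, - 2 * (a - c * a'), m * m:]"
      using m(2) by (simp add: l_def power2_eq_square) (simp add: algebra_simps)
    ultimately have "?p = [:c:] * ?q + l\<^sup>2"
      unfolding m(1) by (simp add: algebra_simps)
    then show ?thesis
      using conic_solvable_of_pencil conic_solvable_uminus_one assms c \<open>c \<noteq> 0\<close>
      by (metis less_eq_real_def)
  next
    \<comment> \<open>At \<open>c = 1\<close> the pencil member is the constant
      \<open>b^2 - b'^2\<close>, a square after exchanging the quadratics if necessary.\<close>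
    case True
    then have "a = a'" using c(3) by (simp add: h_def)
    show ?thesis
    proof (cases "b\<^sup>2 \<ge> b'\<^sup>2")
      case True
      then have "?p = [:1:] * ?q + [:sqrt (b\<^sup>2 - b'\<^sup>2):]\<^sup>2"
        using \<open>a = a'\<close> by (simp add: power2_eq_square)
      then show ?thesis
        using conic_solvable_of_pencil conic_solvable_uminus_one assms zero_less_one by metis
    next
      case False
      then have "?q = [:1:] * ?p + [:sqrt (b'\<^sup>2 - b\<^sup>2):]\<^sup>2"
        using \<open>a = a'\<close> by (simp add: power2_eq_square)
      then have "conic_solvable ?q ?p"
        using conic_solvable_of_pencil conic_solvable_uminus_one assms zero_less_one by metis
      then show ?thesis using conic_solvable_commute by fastforce
    qed
  qed
qed

text \<open>Reduction to quadratics is applied to each argument in turn, with the symmetry of the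
  conic in between.\<close>

lemma conic_solvable_nonneg:
  fixes p q :: "real poly"
  assumes "\<And>x. poly p x \<ge> 0" "\<And>x. poly q x \<ge> 0" "p \<noteq> 0"
  shows "conic_solvable p q"
proof (rule conic_solvable_of_quadratics[OF _ assms(2)])
  fix a b :: real assume "b \<noteq> 0"
  then have "conic_solvable [:a\<^sup>2 + b\<^sup>2, - 2 * a, 1:] p"
    using conic_solvable_of_quadratics conic_solvable_quadratics assms(1) by blast
  then show "conic_solvable p [:a\<^sup>2 + b\<^sup>2, - 2 * a, 1:]"
    using conic_solvable_commute assms(3) by blast
qed

subsection \<open>Shortening representations\<close>

lemma gram_eliminate_coordinate:
  fixes q :: "'k \<Rightarrow> 'i \<Rightarrow> real poly"
  assumes "finite I" "finite K" "card K + 2 \<le> card I" "i\<^sub>0 \<in> I"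
  shows "\<exists>q'. (\<forall>k\<in>K. \<forall>l\<in>K. dot I (q' k) (q' l) = dot I (q k) (q l)) \<and> (\<forall>k\<in>K. q' k i\<^sub>0 = 0)"
proof -
  have "card K < card I" using assms(3) by simp
  from homogeneous_system_nontrivial_solution[OF assms(2,1) this, of q]
  obtain u where u: "\<exists>i\<in>I. u i \<noteq> 0" "\<forall>k\<in>K. dot I (q k) u = 0"
    unfolding dot_def by blast
  \<comment> \<open>The index \<open>None\<close> carries the additional equation
    \<open>(u, v) = 0\<close>; the bound \<open>card K + 2\<close> leaves room for it.\<close>
  have "finite (insert None (Some ` K))" "card (insert None (Some ` K)) < card I"
    using assms by (auto simp: card_image)
  from homogeneous_system_nontrivial_solution[OF this(1) \<open>finite I\<close> this(2), of "case_option u q"]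
  obtain v where v: "\<exists>i\<in>I. v i \<noteq> 0" "\<forall>k\<in>K. dot I (q k) v = 0" "dot I u v = 0"
    unfolding dot_def by auto
  have nonneg: "poly (dot I w w) x \<ge> 0" for w :: "'i \<Rightarrow> real poly" and x
    unfolding poly_dot by (intro sum_nonneg) simp
  have nz: "dot I u u \<noteq> 0" "dot I v v \<noteq> 0"
    using u(1) v(1) dot_self_eq_0_iff[OF \<open>finite I\<close>] by auto
  then have "conic_solvable (dot I u u) (dot I v v)"
    using conic_solvable_nonneg nonneg by blast
  then obtain X Y Z where Y: "Y \<noteq> 0" and Z: "Z\<^sup>2 = dot I u u * X\<^sup>2 + dot I v v * Y\<^sup>2"
    unfolding conic_solvable_def by blast
  define c where "c i = X * u i + Y * v i" for i
  have norm_c: "dot I c c = Z\<^sup>2"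
    using v(3) unfolding Z c_def dot_bilinear dot_commute[of I v u]
    by (simp add: power2_eq_square algebra_simps)
  \<comment> \<open>As \<open>Y\<close> is nonzero, \<open>c\<close> is not the zero vector, so
    \<open>Z\<close> is nonzero as the descent demands.\<close>
  have "dot I v c = Y * dot I v v"
    using v(3) unfolding c_def dot_bilinear dot_commute[of I v u] by simp
  then have "dot I c c \<noteq> 0"
    using Y nz dot_self_eq_0_iff[OF \<open>finite I\<close>, of c] by (auto simp: dot_def)
  then have "Z \<noteq> 0" using norm_c by auto
  have orth_c: "\<forall>k\<in>K. dot I (q k) c = 0"
    using u(2) v(2) unfolding c_def dot_bilinear by simp
  from descend_to_constant_vector[OF \<open>finite I\<close> \<open>Z \<noteq> 0\<close> norm_c orth_c]
  obtain q' c0 where q': "\<forall>k\<in>K. \<forall>l\<in>K. dot I (q' k) (q' l) = dot I (q k) (q l)"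
    "\<exists>i\<in>I. c0 i \<noteq> 0" "\<forall>k\<in>K. dot I (q' k) (\<lambda>i. [:c0 i:]) = 0"
    by (elim exE conjE) (rule that)
  obtain q'' where "\<forall>k\<in>K. \<forall>l\<in>K. dot I (q'' k) (q'' l) = dot I (q' k) (q' l)"
    "\<forall>k\<in>K. q'' k i\<^sub>0 = 0"
    using eliminate_coordinate[OF assms(1,4) q'(2,3)] by (elim exE conjE) (rule that)
  then show ?thesis using q'(1) by (intro exI[of _ q'']) simp
qed

lemma gram_reduce:
  fixes q :: "'k \<Rightarrow> nat \<Rightarrow> real poly"
  assumes "finite K"
  shows "\<exists>q'. \<forall>k\<in>K. \<forall>l\<in>K. dot {..<card K + 1} (q' k) (q' l) = dot {..<N} (q k) (q l)"
proof (induction N arbitrary: q)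
  case 0
  show ?case by (intro exI[of _ "\<lambda>_ _. 0"]) (simp add: dot_def)
next
  case (Suc N)
  show ?case
  proof (cases "card K + 1 \<le> N")
    case True
    then obtain q' where q': "\<forall>k\<in>K. \<forall>l\<in>K. dot {..<Suc N} (q' k) (q' l) = dot {..<Suc N} (q k) (q l)"
      "\<forall>k\<in>K. q' k N = 0"
      using gram_eliminate_coordinate[of "{..<Suc N}" K N q] assms by auto
    then have "\<forall>k\<in>K. \<forall>l\<in>K. dot {..<N} (q' k) (q' l) = dot {..<Suc N} (q k) (q l)"
      by (simp add: dot_def)
    then show ?thesis using Suc.IH[of q'] by auto
  next
    case False
    \<comment> \<open>There are few enough coordinates already; zeros fill up to exactly
      \<open>card K + 1\<close>.\<close>
    have sub: "{..<Suc N} \<subseteq> {..<card K + 1}" using False by auto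
    have "dot {..<card K + 1} (\<lambda>i. if i < Suc N then q k i else 0) (\<lambda>i. if i < Suc N then q l i else 0)
        = dot {..<Suc N} (q k) (q l)" for k l
      unfolding dot_def by (rule sum.mono_neutral_cong_right) (use sub in auto)
    then show ?thesis by (intro exI[of _ "\<lambda>k i. if i < Suc N then q k i else 0"]) blast
  qed
qed

subsection \<open>Substitution into forms\<close>

definition eval_monomial :: "(nat \<Rightarrow> 'a::comm_ring_1) \<Rightarrow> monomial \<Rightarrow> 'a" where
  "eval_monomial v m = (\<Prod>i\<in>Poly_Mapping.keys m. v i ^ Poly_Mapping.lookup m i)"

lemma eval_monomial_superset:
  assumes "finite S" "Poly_Mapping.keys m \<subseteq> S"
  shows "eval_monomial v m = (\<Prod>i\<in>S. v i ^ Poly_Mapping.lookup m i)"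
  unfolding eval_monomial_def
  by (rule prod.mono_neutral_left) (use assms in \<open>auto simp: in_keys_iff\<close>)

lemma eval_monomial_add: "eval_monomial v (m + n) = eval_monomial v m * eval_monomial v n"
proof -
  let ?S = "Poly_Mapping.keys m \<union> Poly_Mapping.keys n"
  have "finite ?S" "Poly_Mapping.keys (m + n) \<subseteq> ?S" using Poly_Mapping.keys_add[of m n] by auto
  then show ?thesis
    by (subst (1 2 3) eval_monomial_superset[of ?S])
      (auto simp: lookup_add power_add prod.distrib)
qed

lemma eval_monomial_single [simp]: "eval_monomial v (Poly_Mapping.single i n) = v i ^ n"
  by (subst eval_monomial_superset[of "{i}"]) auto

lemma monomial_degree_superset:
  assumes "finite S" "Poly_Mapping.keys m \<subseteq> S"
  shows "monomial_degree m = (\<Sum>i\<in>S. Poly_Mapping.lookup m i)"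
  unfolding monomial_degree_def
  by (rule sum.mono_neutral_left) (use assms in \<open>auto simp: in_keys_iff\<close>)

lemma monomial_degree_add: "monomial_degree (m + n) = monomial_degree m + monomial_degree n"
proof -
  let ?S = "Poly_Mapping.keys m \<union> Poly_Mapping.keys n"
  have "finite ?S" "Poly_Mapping.keys (m + n) \<subseteq> ?S" using Poly_Mapping.keys_add[of m n] by auto
  then show ?thesis
    by (subst (1 2 3) monomial_degree_superset[of ?S]) (auto simp: lookup_add sum.distrib)
qed

lemma monomial_degree_single [simp]: "monomial_degree (Poly_Mapping.single i n) = n"
  by (subst monomial_degree_superset[of "{i}"]) auto

lemma poly_mapping_eq_sum_single:
  "p = (\<Sum>m\<in>Poly_Mapping.keys p. Poly_Mapping.single m (Poly_Mapping.lookup p m))"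
  by (rule poly_mapping_eqI) (auto simp: lookup_sum lookup_single when_def in_keys_iff)

text \<open>Abstracting over the embedding of the scalars lets one development serve the
  substitutions into \<open>real poly poly\<close> and into \<open>real poly\<close>.\<close>

locale scalar_hom =
  fixes h :: "real \<Rightarrow> 'a::comm_ring_1"
  assumes hom_0 [simp]: "h 0 = 0" and hom_1 [simp]: "h 1 = 1"
    and hom_add: "h (x + y) = h x + h y" and hom_mult: "h (x * y) = h x * h y"
begin

definition subst :: "(nat \<Rightarrow> 'a) \<Rightarrow> real_mpoly \<Rightarrow> 'a" where
  "subst v p = (\<Sum>m\<in>Poly_Mapping.keys p. h (Poly_Mapping.lookup p m) * eval_monomial v m)"

lemma subst_superset:
  assumes "finite S" "Poly_Mapping.keys p \<subseteq> S"
  shows "subst v p = (\<Sum>m\<in>S. h (Poly_Mapping.lookup p m) * eval_monomial v m)"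
  unfolding subst_def
  by (rule sum.mono_neutral_left) (use assms in \<open>auto simp: in_keys_iff\<close>)

lemma subst_0 [simp]: "subst v 0 = 0"
  by (simp add: subst_def)

lemma subst_single [simp]: "subst v (Poly_Mapping.single m c) = h c * eval_monomial v m"
  by (subst subst_superset[of "{m}"]) auto

lemma subst_1 [simp]: "subst v 1 = 1"
  using subst_single[of v 0 1] by (simp add: eval_monomial_def single_one)

lemma subst_add: "subst v (p + q) = subst v p + subst v q"
proof -
  let ?S = "Poly_Mapping.keys p \<union> Poly_Mapping.keys q"
  have "finite ?S" "Poly_Mapping.keys (p + q) \<subseteq> ?S" using Poly_Mapping.keys_add[of p q] by auto
  then show ?thesis
    by (subst (1 2 3) subst_superset[of ?S])
      (auto simp: lookup_add hom_add distrib_right sum.distrib)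
qed

lemma subst_sum: "subst v (\<Sum>i\<in>I. p i) = (\<Sum>i\<in>I. subst v (p i))"
  by (induction I rule: infinite_finite_induct) (auto simp: subst_add)

lemma subst_mult: "subst v (p * q) = subst v p * subst v q"
proof -
  let ?c = Poly_Mapping.lookup
  have "subst v (p * q) = subst v ((\<Sum>m\<in>Poly_Mapping.keys p. Poly_Mapping.single m (?c p m)) *
      (\<Sum>n\<in>Poly_Mapping.keys q. Poly_Mapping.single n (?c q n)))"
    by (simp flip: poly_mapping_eq_sum_single)
  also have "\<dots> = (\<Sum>m\<in>Poly_Mapping.keys p. \<Sum>n\<in>Poly_Mapping.keys q.
      (h (?c p m) * eval_monomial v m) * (h (?c q n) * eval_monomial v n))"
    unfolding sum_product subst_sum
    by (simp add: mult_single eval_monomial_add hom_mult mult_ac)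
  also have "\<dots> = subst v p * subst v q"
    unfolding subst_def sum_product ..
  finally show ?thesis .
qed

lemma subst_prod: "subst v (\<Prod>i\<in>I. p i) = (\<Prod>i\<in>I. subst v (p i))"
  by (induction I rule: infinite_finite_induct) (auto simp: subst_mult)

lemma subst_power2: "subst v (p\<^sup>2) = (subst v p)\<^sup>2"
  by (simp add: power2_eq_square subst_mult)

end

section \<open>Closure properties of spaces of forms\<close>

lemma forms_0 [simp]: "0 \<in> forms n e"
  by (simp add: forms_def)

lemma forms_add: "p \<in> forms n e \<Longrightarrow> q \<in> forms n e \<Longrightarrow> p + q \<in> forms n e"
  unfolding forms_def using Poly_Mapping.keys_add[of p q] by blast

lemma forms_diff: "p \<in> forms n e \<Longrightarrow> q \<in> forms n e \<Longrightarrow> p - q \<in> forms n e"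
  unfolding forms_def using Poly_Mapping.keys_diff[of p q] by blast

lemma forms_sum: "(\<And>i. i \<in> I \<Longrightarrow> p i \<in> forms n e) \<Longrightarrow> (\<Sum>i\<in>I. p i) \<in> forms n e"
  by (induction I rule: infinite_finite_induct) (auto intro: forms_add)

lemma forms_single:
  "Poly_Mapping.keys m \<subseteq> {..<n} \<Longrightarrow> monomial_degree m = e \<Longrightarrow> Poly_Mapping.single m c \<in> forms n e"
  by (simp add: forms_def)

lemma forms_mult:
  assumes "p \<in> forms n d" "q \<in> forms n e"
  shows "p * q \<in> forms n (d + e)"
proof -
  have "Poly_Mapping.keys m \<subseteq> {..<n} \<and> monomial_degree m = d + e"
    if m_pq: "m \<in> Poly_Mapping.keys (p * q)" for m
  proof -
    obtain a b where m: "m = a + b" and ab: "a \<in> Poly_Mapping.keys p" "b \<in> Poly_Mapping.keys q"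
      using subsetD[OF Poly_Mapping.keys_mult m_pq] by blast
    then have "Poly_Mapping.keys a \<subseteq> {..<n}" "Poly_Mapping.keys b \<subseteq> {..<n}"
      "monomial_degree a = d" "monomial_degree b = e"
      using assms unfolding forms_def by auto
    then show ?thesis using Poly_Mapping.keys_add[of a b] unfolding m
      by (auto simp: monomial_degree_add)
  qed
  then show ?thesis by (simp add: forms_def)
qed

lemma forms_power2: "p \<in> forms n d \<Longrightarrow> p\<^sup>2 \<in> forms n (2 * d)"
  using forms_mult[of p n d p d] by (simp add: power2_eq_square mult_2)

lemma forms_prod:
  assumes "finite I" "\<And>i. i \<in> I \<Longrightarrow> p i \<in> forms n 1"
  shows "(\<Prod>i\<in>I. p i) \<in> forms n (card I)"
  using assms
proof (induction I rule: finite_induct)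
  case empty
  have "Poly_Mapping.single 0 1 \<in> forms n 0"
    by (rule forms_single) (auto simp: monomial_degree_def)
  then show ?case by (simp add: single_one)
next
  case (insert i I)
  then show ?case using forms_mult[of "p i" n 1] by simp
qed

lemma ternary_monomial:
  assumes "p \<in> forms 3 e" "m \<in> Poly_Mapping.keys p"
  shows "eval_monomial v m
      = v 0 ^ Poly_Mapping.lookup m 0 * v 1 ^ Poly_Mapping.lookup m 1 * v 2 ^ Poly_Mapping.lookup m 2"
    and "Poly_Mapping.lookup m 0 + Poly_Mapping.lookup m 1 + Poly_Mapping.lookup m 2 = e"
proof -
  have m: "Poly_Mapping.keys m \<subseteq> {..<3}" "monomial_degree m = e"
    using assms by (auto simp: forms_def)
  have "{..<3::nat} = {0, 1, 2}" by auto
  then show "eval_monomial v m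
      = v 0 ^ Poly_Mapping.lookup m 0 * v 1 ^ Poly_Mapping.lookup m 1 * v 2 ^ Poly_Mapping.lookup m 2"
    using eval_monomial_superset[of "{..<3}" m v] m(1) by (simp add: mult.assoc)
  show "Poly_Mapping.lookup m 0 + Poly_Mapping.lookup m 1 + Poly_Mapping.lookup m 2 = e"
    using monomial_degree_superset[of "{..<3}" m] m \<open>{..<3::nat} = {0, 1, 2}\<close> by simp
qed

lemma ternary_monomial_eqI:
  fixes m n :: monomial
  assumes "Poly_Mapping.keys m \<subseteq> {..<3}" "Poly_Mapping.keys n \<subseteq> {..<3}"
    "Poly_Mapping.lookup m 0 = Poly_Mapping.lookup n 0"
    "Poly_Mapping.lookup m 1 = Poly_Mapping.lookup n 1"
    "Poly_Mapping.lookup m 2 = Poly_Mapping.lookup n 2"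
  shows "m = n"
proof (rule poly_mapping_eqI)
  fix k :: nat
  consider "k = 0" | "k = 1" | "k = 2" | "k \<ge> 3" by linarith
  then show "Poly_Mapping.lookup m k = Poly_Mapping.lookup n k"
  proof cases
    case 4
    then have "k \<notin> Poly_Mapping.keys m" "k \<notin> Poly_Mapping.keys n" using assms(1,2) by auto
    then show ?thesis by (simp add: in_keys_iff)
  qed (use assms in auto)
qed

subsection \<open>The upper bound\<close>

interpretation const2: scalar_hom "\<lambda>c. [:[:c:]:]"
  by unfold_locales (auto simp: one_pCons)

text \<open>The second variable is the outer one, so the outer coefficients are the entries in R[x]
  to which \<open>gram_reduce\<close> applies.\<close>

definition dehomogenize :: "real_mpoly \<Rightarrow> real poly poly" where
  "dehomogenize = const2.subst (\<lambda>i. if i = 0 then [:[:0, 1:]:] else if i = 1 then [:0, 1:] else 1)"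

lemma dehomogenize_form:
  assumes "p \<in> forms 3 e"
  shows "dehomogenize p = (\<Sum>m\<in>Poly_Mapping.keys p.
    monom (monom (Poly_Mapping.lookup p m) (Poly_Mapping.lookup m 0)) (Poly_Mapping.lookup m 1))"
  unfolding dehomogenize_def const2.subst_def
proof (rule sum.cong[OF refl])
  fix m assume "m \<in> Poly_Mapping.keys p"
  show "[:[:Poly_Mapping.lookup p m:]:] * eval_monomial
      (\<lambda>i. if i = 0 then [:[:0, 1:]:] else if i = 1 then [:0, 1:] else 1) m
    = monom (monom (Poly_Mapping.lookup p m) (Poly_Mapping.lookup m 0)) (Poly_Mapping.lookup m 1)"
    unfolding ternary_monomial(1)[OF assms \<open>m \<in> _\<close>]
    by (simp add: monom_altdef poly_const_pow)
qed

text \<open>The degree determines the exponent of the third variable, so distinct monomials of a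
  form do not collide.\<close>

lemma coeff_dehomogenize:
  assumes "p \<in> forms 3 e" "m \<in> Poly_Mapping.keys p"
  shows "coeff (coeff (dehomogenize p) (Poly_Mapping.lookup m 1)) (Poly_Mapping.lookup m 0)
    = Poly_Mapping.lookup p m"
proof -
  have eq: "n = m" if "n \<in> Poly_Mapping.keys p" "Poly_Mapping.lookup n 0 = Poly_Mapping.lookup m 0"
    "Poly_Mapping.lookup n 1 = Poly_Mapping.lookup m 1" for n
    using ternary_monomial(2)[OF assms(1) that(1)] ternary_monomial(2)[OF assms] assms that
    by (intro ternary_monomial_eqI) (auto simp: forms_def)
  have "coeff (coeff (dehomogenize p) (Poly_Mapping.lookup m 1)) (Poly_Mapping.lookup m 0)
    = (\<Sum>n\<in>Poly_Mapping.keys p. if n = m then Poly_Mapping.lookup p n else 0)"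
    unfolding dehomogenize_form[OF assms(1)] coeff_sum
    by (rule sum.cong) (use eq in \<open>auto\<close>)
  then show ?thesis using assms(2) by simp
qed

lemma dehomogenize_inject:
  assumes "p \<in> forms 3 e" "q \<in> forms 3 e" "dehomogenize p = dehomogenize q"
  shows "p = q"
proof -
  have "dehomogenize (p - q) + dehomogenize q = dehomogenize p"
    unfolding dehomogenize_def const2.subst_add[symmetric] by simp
  then have "dehomogenize (p - q) = 0" using assms(3) by simp
  then have "Poly_Mapping.lookup (p - q) m = 0" if "m \<in> Poly_Mapping.keys (p - q)" for m
    using coeff_dehomogenize[OF forms_diff[OF assms(1,2)] that] by simp
  then have "Poly_Mapping.keys (p - q) = {}" by (metis in_keys_iff equals0I)
  then show ?thesis by simp
qed

lemma degree_dehomogenize: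
  assumes "p \<in> forms 3 e"
  shows "degree (dehomogenize p) \<le> e" "degree (poly (dehomogenize p) [:0, l:]) \<le> e"
proof -
  have deg: "Poly_Mapping.lookup m 0 + Poly_Mapping.lookup m 1 \<le> e"
    if "m \<in> Poly_Mapping.keys p" for m
    using ternary_monomial(2)[OF assms that] by simp
  show "degree (dehomogenize p) \<le> e"
    unfolding dehomogenize_form[OF assms]
  proof (rule degree_sum_le)
    fix m assume "m \<in> Poly_Mapping.keys p"
    from deg[OF this]
    show "degree (monom (monom (Poly_Mapping.lookup p m) (Poly_Mapping.lookup m 0)) (Poly_Mapping.lookup m 1)) \<le> e"
      by (meson degree_monom_le le_trans add_leD2)
  qed simp
  show "degree (poly (dehomogenize p) [:0, l:]) \<le> e"
    unfolding dehomogenize_form[OF assms] poly_sum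
  proof (rule degree_sum_le)
    fix m assume "m \<in> Poly_Mapping.keys p"
    have "degree (monom (Poly_Mapping.lookup p m) (Poly_Mapping.lookup m 0) * [:0, l:] ^ Poly_Mapping.lookup m 1)
        \<le> Poly_Mapping.lookup m 0 + 1 * Poly_Mapping.lookup m 1"
      by (intro degree_mult_le[THEN le_trans] add_mono degree_monom_le
          degree_power_le[THEN le_trans] mult_right_mono) auto
    then show "degree (poly (monom (monom (Poly_Mapping.lookup p m) (Poly_Mapping.lookup m 0)) (Poly_Mapping.lookup m 1)) [:0, l:]) \<le> e"
      using deg[OF \<open>m \<in> _\<close>] by (simp add: poly_monom)
  qed simp
qed

text \<open>On the line \<open>x\<^sub>1 = l x\<^sub>0\<close> the coefficients of \<open>Q\<close> of total degree \<open>j + k\<close> become a polynomial in \<open>l\<close>.\<close>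

lemma total_degree_le:
  fixes Q :: "real poly poly"
  assumes "\<And>l. degree (poly Q [:0, l:]) \<le> e" "j + k > e"
  shows "coeff (coeff Q k) j = 0"
proof -
  define R where "R = (\<Sum>i\<le>degree Q.
    monom (if i \<le> j + k then coeff (coeff Q i) (j + k - i) else 0) i)"
  have "poly R l = coeff (poly Q [:0, l:]) (j + k)" for l
  proof -
    have pow: "[:0, l:] ^ i = monom (l ^ i) i" for i
      using monom_power[of l 1 i] by (simp add: monom_altdef)
    have "coeff (poly Q [:0, l:]) (j + k) = (\<Sum>i\<le>degree Q. coeff (monom (l ^ i) i * coeff Q i) (j + k))"
      by (simp add: poly_altdef coeff_sum pow mult.commute)
    also have "\<dots> = poly R l"
      unfolding R_def poly_sum by (rule sum.cong) (auto simp: coeff_monom_mult poly_monom)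
    finally show ?thesis ..
  qed
  then have "poly R l = 0" for l
    using le_less_trans[OF assms(1)[of l] assms(2)] by (simp add: coeff_eq_0)
  then have "R = 0" by (metis poly_all_0_iff_0)
  then have "coeff R k = 0" by simp
  then show ?thesis
    by (cases "k \<le> degree Q") (auto simp: R_def coeff_sum coeff_eq_0)
qed

definition ternary :: "nat \<Rightarrow> nat \<Rightarrow> nat \<Rightarrow> monomial" where
  "ternary a b c = Poly_Mapping.single 0 a + Poly_Mapping.single 1 b + Poly_Mapping.single 2 c"

lemma keys_ternary: "Poly_Mapping.keys (ternary a b c) \<subseteq> {..<3}"
proof -
  have "Poly_Mapping.keys (ternary a b c) \<subseteq> {0, 1, 2}"
    by (auto simp: ternary_def in_keys_iff lookup_add lookup_single when_def split: if_splits)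
  then show ?thesis by auto
qed

lemma monomial_degree_ternary: "monomial_degree (ternary a b c) = a + b + c"
  by (simp add: ternary_def monomial_degree_add)

lemma homogenize:
  fixes Q :: "real poly poly"
  assumes "\<And>j k. j + k > e \<Longrightarrow> coeff (coeff Q k) j = 0"
  shows "\<exists>p\<in>forms 3 e. dehomogenize p = Q"
proof (rule bexI)
  define p where "p = (\<Sum>k\<le>e. \<Sum>j\<le>e - k.
    Poly_Mapping.single (ternary j k (e - k - j)) (coeff (coeff Q k) j))"
  show "p \<in> forms 3 e"
    unfolding p_def by (intro forms_sum forms_single keys_ternary) (auto simp: monomial_degree_ternary)
  have "dehomogenize p = (\<Sum>k\<le>e. \<Sum>j\<le>e - k. monom (monom (coeff (coeff Q k) j) j) k)"
    unfolding p_def dehomogenize_def const2.subst_sum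
    by (intro sum.cong refl)
      (simp add: ternary_def eval_monomial_add monom_altdef poly_const_pow)
  also have "\<dots> = (\<Sum>k\<le>e. monom (coeff Q k) k)"
  proof (rule sum.cong[OF refl])
    fix k assume "k \<in> {..e}"
    have "degree (coeff Q k) \<le> e - k" using assms by (intro degree_le) auto
    then have "(\<Sum>j\<le>e - k. monom (coeff (coeff Q k) j) j) = coeff Q k"
      by (rule poly_as_sum_of_monoms')
    moreover have "(\<Sum>j\<le>e - k. monom (monom (coeff (coeff Q k) j) j) k)
      = monom (\<Sum>j\<le>e - k. monom (coeff (coeff Q k) j) j) k"
      by (intro poly_eqI) (simp add: coeff_sum)
    ultimately show "(\<Sum>j\<le>e - k. monom (monom (coeff (coeff Q k) j) j) k) = monom (coeff Q k) k"
      by simp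
  qed
  also have "\<dots> = Q"
    using assms by (intro poly_as_sum_of_monoms' degree_le) (auto intro: poly_eqI)
  finally show "dehomogenize p = Q" .
qed

text \<open>The sum of squares depends on the coefficient vectors only through their Gram
  matrix.\<close>

lemma sum_power2_eq_gram:
  fixes q :: "nat \<Rightarrow> 'i \<Rightarrow> 'a::comm_ring_1"
  shows "(\<Sum>i\<in>I. (\<Sum>k\<le>d. monom (q k i) k)\<^sup>2) = (\<Sum>k\<le>d. \<Sum>l\<le>d. monom (dot I (q k) (q l)) (k + l))"
proof -
  have mono: "monom (dot I (q k) (q l)) (k + l) = (\<Sum>i\<in>I. monom (q k i) k * monom (q l i) l)" for k l
    by (intro poly_eqI) (auto simp: dot_def mult_monom coeff_sum)
  have "(\<Sum>i\<in>I. (\<Sum>k\<le>d. monom (q k i) k)\<^sup>2)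
      = (\<Sum>i\<in>I. \<Sum>k\<le>d. \<Sum>l\<le>d. monom (q k i) k * monom (q l i) l)"
    unfolding power2_eq_square sum_product ..
  also have "\<dots> = (\<Sum>k\<le>d. \<Sum>i\<in>I. \<Sum>l\<le>d. monom (q k i) k * monom (q l i) l)"
    by (rule sum.swap)
  also have "\<dots> = (\<Sum>k\<le>d. \<Sum>l\<le>d. \<Sum>i\<in>I. monom (q k i) k * monom (q l i) l)"
    by (intro sum.cong refl sum.swap)
  finally show ?thesis unfolding mono .
qed

lemma ternary_sos_length_le:
  fixes p :: "nat \<Rightarrow> real_mpoly"
  assumes "\<forall>i<r. p i \<in> forms 3 d"
  shows "is_sum_of_squares 3 d (d + 2) (\<Sum>i<r. (p i)\<^sup>2)"
proof -
  define q where "q k i = coeff (dehomogenize (p i)) k" for k i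
  obtain q' where q': "\<forall>k\<in>{..d}. \<forall>l\<in>{..d}. dot {..<d + 2} (q' k) (q' l) = dot {..<r} (q k) (q l)"
    using gram_reduce[of "{..d}" r q] by auto
  define Q where "Q i = (\<Sum>k\<le>d. monom (q' k i) k)" for i
  have "(\<Sum>i<r. (dehomogenize (p i))\<^sup>2) = (\<Sum>i<r. (\<Sum>k\<le>d. monom (q k i) k)\<^sup>2)"
    unfolding q_def using assms
    by (intro sum.cong refl arg_cong[of _ _ "\<lambda>x. x\<^sup>2"] poly_as_sum_of_monoms'[symmetric]
        degree_dehomogenize(1)) auto
  also have "\<dots> = (\<Sum>i<d + 2. (Q i)\<^sup>2)"
    unfolding Q_def sum_power2_eq_gram by (intro sum.cong refl) (use q' in auto)
  finally have sum_Q: "(\<Sum>i<d + 2. (Q i)\<^sup>2) = (\<Sum>i<r. (dehomogenize (p i))\<^sup>2)" ..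
  \<comment> \<open>Gram reduction may a priori raise degrees in the first variable. On each line
    through the origin squares cannot cancel, which bounds the total degree of every
    \<open>Q i\<close>.\<close>
  have "degree (poly (Q i) [:0, l:]) \<le> d" if "i < d + 2" for i l
  proof (rule degree_sum_of_squares[of "{..<d + 2}" i "\<lambda>i. poly (Q i) [:0, l:]"])
    have "(\<Sum>i<d + 2. (poly (Q i) [:0, l:])\<^sup>2) = (\<Sum>i<r. (poly (dehomogenize (p i)) [:0, l:])\<^sup>2)"
      using arg_cong[OF sum_Q, of "\<lambda>P. poly P [:0, l:]"] by (simp add: poly_sum del: sum.lessThan_Suc)
    moreover have "degree \<dots> \<le> 2 * d"
    proof (rule degree_sum_le)
      fix i assume "i \<in> {..<r}"
      then have "degree (poly (dehomogenize (p i)) [:0, l:]) \<le> d"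
        using assms degree_dehomogenize(2) by auto
      then show "degree ((poly (dehomogenize (p i)) [:0, l:])\<^sup>2) \<le> 2 * d"
        using degree_power_le[of "poly (dehomogenize (p i)) [:0, l:]" 2] by simp
    qed simp
    ultimately show "degree (\<Sum>i<d + 2. (poly (Q i) [:0, l:])\<^sup>2) \<le> 2 * d" by simp
  qed (use that in auto)
  then have "\<forall>i<d + 2. \<exists>P\<in>forms 3 d. dehomogenize P = Q i"
    using total_degree_le homogenize by metis
  then obtain P where P: "\<And>i. i < d + 2 \<Longrightarrow> P i \<in> forms 3 d"
    "\<And>i. i < d + 2 \<Longrightarrow> dehomogenize (P i) = Q i"
    by metis
  have "(\<Sum>i<r. (p i)\<^sup>2) = (\<Sum>i<d + 2. (P i)\<^sup>2)"
  proof (rule dehomogenize_inject)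
    show "(\<Sum>i<r. (p i)\<^sup>2) \<in> forms 3 (2 * d)" "(\<Sum>i<d + 2. (P i)\<^sup>2) \<in> forms 3 (2 * d)"
      using assms P(1) by (auto intro!: forms_sum forms_power2 simp del: sum.lessThan_Suc)
    have "dehomogenize (\<Sum>i<d + 2. (P i)\<^sup>2) = (\<Sum>i<d + 2. (Q i)\<^sup>2)"
      using P(2) by (simp add: dehomogenize_def const2.subst_sum const2.subst_power2 del: sum.lessThan_Suc)
    then show "dehomogenize (\<Sum>i<r. (p i)\<^sup>2) = dehomogenize (\<Sum>i<d + 2. (P i)\<^sup>2)"
      unfolding sum_Q by (simp add: dehomogenize_def const2.subst_sum const2.subst_power2)
  qed
  then show ?thesis using P(1) unfolding is_sum_of_squares_def by blast
qed

subsection \<open>The lower bound\<close>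

definition node_poly :: "nat \<Rightarrow> nat \<Rightarrow> real poly" where
  "node_poly d i = (\<Prod>j\<in>{..d} - {i}. [:- real j, 1:])"

lemma poly_node_poly_eq_0_iff:
  assumes "j \<le> d"
  shows "poly (node_poly d i) (real j) = 0 \<longleftrightarrow> j \<noteq> i"
  using assms by (auto simp: node_poly_def poly_prod)

lemma degree_node_poly: "i \<le> d \<Longrightarrow> degree (node_poly d i) = d"
  by (simp add: node_poly_def degree_prod_sum_eq)

lemma poly_pderiv_node_poly:
  assumes "j \<le> d" "j \<noteq> i"
  shows "poly (pderiv (node_poly d i)) (real j) \<noteq> 0"
proof -
  define R where "R = (\<Prod>k\<in>{..d} - {i} - {j}. [:- real k, 1:])"
  have N: "node_poly d i = [:- real j, 1:] * R"
    unfolding node_poly_def R_def using assms by (intro prod.remove) auto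
  have "poly R (real j) \<noteq> 0" by (auto simp: R_def poly_prod)
  then show ?thesis unfolding N pderiv_mult by (simp add: pderiv_pCons)
qed

text \<open>Lagrange interpolation at \<open>0, ..., d\<close>: the difference has
  \<open>d + 1\<close> roots but degree at most \<open>d\<close>.\<close>

lemma node_interpolation:
  assumes "degree P \<le> d"
  shows "P = (\<Sum>j\<le>d. smult (poly P (real j) / poly (node_poly d j) (real j)) (node_poly d j))"
    (is "P = ?S")
proof (rule ccontr)
  assume "P \<noteq> ?S"
  then have nz: "P - ?S \<noteq> 0" by simp
  have "poly ?S (real i) = poly P (real i)" if "i \<le> d" for i
  proof -
    have "poly ?S (real i) = (\<Sum>j\<le>d. if j = i then poly P (real i) else 0)"
      unfolding poly_sum
      by (rule sum.cong) (use that in \<open>auto simp: poly_node_poly_eq_0_iff\<close>)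
    then show ?thesis using that by simp
  qed
  then have "real ` {..d} \<subseteq> {x. poly (P - ?S) x = 0}" by auto
  then have "card (real ` {..d}) \<le> card {x. poly (P - ?S) x = 0}"
    using nz by (intro card_mono poly_roots_finite)
  also have "\<dots> \<le> degree (P - ?S)" using nz by (rule card_poly_roots_bound)
  also have "\<dots> \<le> d"
    using assms by (intro degree_diff_le degree_sum_le) (auto simp: degree_node_poly intro: degree_smult_le[THEN le_trans])
  finally show False by (simp add: card_image)
qed

lemma sum_pderiv_eq_0:
  fixes W :: "'t \<Rightarrow> real poly"
  assumes "finite T" "\<And>x. (\<Sum>t\<in>T. c t * poly (W t) x) = 0"
  shows "(\<Sum>t\<in>T. c t * poly (pderiv (W t)) x) = 0"
proof -
  define S where "S = (\<Sum>t\<in>T. smult (c t) (W t))"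
  have "poly S x = 0" for x using assms(2) by (simp add: S_def poly_sum)
  then have "S = 0" by (metis poly_all_0_iff_0)
  then have "poly (pderiv S) x = 0" by simp
  moreover have "pderiv S = (\<Sum>t\<in>T. smult (c t) (pderiv (W t)))"
    unfolding S_def using \<open>finite T\<close>
    by (induction T rule: finite_induct) (auto simp: pderiv_add pderiv_smult)
  ultimately show ?thesis by (simp add: poly_sum)
qed

text \<open>For \<open>a = b\<close>, evaluation at \<open>u = s = a\<close> isolates
  \<open>g a a\<close>. For \<open>a \<noteq> b\<close>, differentiating in both variables and
  evaluating at \<open>a\<close> and \<open>b\<close> leaves only the two terms of
  \<open>g a b\<close> and \<open>g b a\<close>, which agree by symmetry.\<close>

lemma node_products_independent:
  fixes g :: "nat \<Rightarrow> nat \<Rightarrow> real"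
  assumes sym: "\<And>i j. g i j = g j i"
    and eq: "\<And>u s. (\<Sum>i\<le>d. \<Sum>j\<le>d. g i j * poly (node_poly d i * node_poly d j) u
        * poly (node_poly d i * node_poly d j) s) = 0"
    and "a \<le> d" "b \<le> d"
  shows "g a b = 0"
proof -
  define W where "W = (\<lambda>(i, j). node_poly d i * node_poly d j)"
  let ?T = "{..d} \<times> {..d}"
  have eq': "(\<Sum>t\<in>?T. case_prod g t * poly (W t) u * poly (W t) s) = 0" for u s
    using eq[of u s] by (simp add: W_def sum.cartesian_product split_def)
  show ?thesis
  proof (cases "a = b")
    case True
    have "(\<Sum>t\<in>?T. case_prod g t * poly (W t) a * poly (W t) a)
        = (\<Sum>t\<in>{(a, a)}. case_prod g t * poly (W t) a * poly (W t) a)"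
      by (rule sum.mono_neutral_right)
        (use assms in \<open>auto simp: W_def poly_node_poly_eq_0_iff\<close>)
    then have "g a a * poly (W (a, a)) a * poly (W (a, a)) a = 0" using eq' by simp
    then show ?thesis using True assms by (auto simp: W_def poly_node_poly_eq_0_iff)
  next
    case False
    \<comment> \<open>A product of two node polynomials, neither with index \<open>c\<close>, has a
      double zero at \<open>c\<close>.\<close>
    have deriv_0: "poly (pderiv (W (i, j))) c = 0" if "c \<le> d" "i \<noteq> c" "j \<noteq> c" for i j c :: nat
    proof -
      have "poly (node_poly d i) c = 0" "poly (node_poly d j) c = 0"
        using that poly_node_poly_eq_0_iff by auto
      then show ?thesis by (simp add: W_def pderiv_mult)
    qed
    have "(\<Sum>t\<in>?T. case_prod g t * poly (W t) u * poly (pderiv (W t)) b) = 0" for u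
      by (rule sum_pderiv_eq_0) (use eq' in auto)
    then have "(\<Sum>t\<in>?T. case_prod g t * poly (pderiv (W t)) b * poly (pderiv (W t)) a) = 0"
      by (intro sum_pderiv_eq_0) (auto simp: mult_ac)
    moreover have "(\<Sum>t\<in>?T. case_prod g t * poly (pderiv (W t)) b * poly (pderiv (W t)) a)
        = (\<Sum>t\<in>{(a, b), (b, a)}. case_prod g t * poly (pderiv (W t)) b * poly (pderiv (W t)) a)"
    proof (rule sum.mono_neutral_right)
      show "\<forall>t\<in>?T - {(a, b), (b, a)}.
          case_prod g t * poly (pderiv (W t)) b * poly (pderiv (W t)) a = 0"
      proof
        fix t assume "t \<in> ?T - {(a, b), (b, a)}"
        then obtain i j where "t = (i, j)" "(i, j) \<noteq> (a, b)" "(i, j) \<noteq> (b, a)"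
          by (cases t) auto
        moreover from this have "i \<noteq> a \<and> j \<noteq> a \<or> i \<noteq> b \<and> j \<noteq> b" using False by auto
        ultimately show "case_prod g t * poly (pderiv (W t)) b * poly (pderiv (W t)) a = 0"
          using deriv_0[of a i j] deriv_0[of b i j] assms(3,4) by auto
      qed
    qed (use assms in auto)
    ultimately have "g a b * poly (pderiv (W (a, b))) b * poly (pderiv (W (a, b))) a
        + g b a * poly (pderiv (W (b, a))) b * poly (pderiv (W (b, a))) a = 0"
      using False by simp
    then have "2 * (g a b * poly (pderiv (W (a, b))) b * poly (pderiv (W (a, b))) a) = 0"
      unfolding W_def by (auto simp: sym[of b a] mult.commute[of "node_poly d b"])
    moreover have "poly (pderiv (W (a, b))) b \<noteq> 0" "poly (pderiv (W (a, b))) a \<noteq> 0"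
    proof -
      have "poly (node_poly d a) b = 0" "poly (node_poly d b) a = 0"
        "poly (node_poly d a) a \<noteq> 0" "poly (node_poly d b) b \<noteq> 0"
        using assms False poly_node_poly_eq_0_iff by metis+
      then show "poly (pderiv (W (a, b))) b \<noteq> 0" "poly (pderiv (W (a, b))) a \<noteq> 0"
        using assms False by (auto simp: W_def pderiv_mult poly_pderiv_node_poly)
    qed
    ultimately show ?thesis by simp
  qed
qed

text \<open>Orthonormal columns give \<open>B^T B = 1\<close>, so \<open>B x = 0\<close> implies
  \<open>x = 0\<close>; more columns than rows would allow a nonzero kernel vector.\<close>

lemma orthonormal_le_dimension:
  fixes b :: "nat \<Rightarrow> nat \<Rightarrow> real"
  assumes "\<And>i j. i < n \<Longrightarrow> j < n \<Longrightarrow> (\<Sum>k<r. b k i * b k j) = (if i = j then 1 else 0)"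
  shows "n \<le> r"
proof (rule ccontr)
  assume "\<not> n \<le> r"
  then obtain x where x: "\<exists>j<n. x j \<noteq> 0" "\<forall>k<r. (\<Sum>j<n. b k j * x j) = 0"
    using homogeneous_system_nontrivial_solution[of "{..<r}" "{..<n}" b] by auto
  have "x j = 0" if "j < n" for j
  proof -
    have "x j = (\<Sum>i<n. (\<Sum>k<r. b k j * b k i) * x i)"
      using that by (simp add: assms if_distrib[of "\<lambda>t. t * _"] cong: if_cong)
    also have "\<dots> = (\<Sum>i<n. \<Sum>k<r. b k j * (b k i * x i))"
      by (simp add: sum_distrib_right mult.assoc)
    also have "\<dots> = (\<Sum>k<r. b k j * (\<Sum>i<n. b k i * x i))"
      by (subst sum.swap) (simp add: sum_distrib_left)
    finally show ?thesis using x(2) by simp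
  qed
  then show False using x(1) by auto
qed

section \<open>Pulling forms back to pairs of roots\<close>

interpretation const1: scalar_hom "\<lambda>c. [:c:]"
  by unfold_locales (auto simp: one_pCons)

text \<open>
  The point parametrized by \<open>(u, s)\<close> is \<open>(us, -(u + s), 1)\<close>, the coefficient vector of the polynomial
  with roots \<open>u\<close> and \<open>s\<close>; the line \<open>x\<^sub>0 + j x\<^sub>1 + j\<^sup>2 x\<^sub>2 = 0\<close> becomes \<open>u = j \<or> s = j\<close>.
\<close>

definition root_pair :: "real \<Rightarrow> nat \<Rightarrow> real poly" where
  "root_pair u i = (if i = 0 then [:0, u:] else if i = 1 then [:- u, - 1:] else 1)"

text \<open>Fixing \<open>u\<close> as a number and keeping \<open>s\<close> as the indeterminate
  makes univariate interpolation available; symmetry later gives the same control in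
  \<open>u\<close>.\<close>

definition pull_back :: "real \<Rightarrow> real_mpoly \<Rightarrow> real poly" where
  "pull_back u = const1.subst (root_pair u)"

lemma degree_pull_back:
  assumes "p \<in> forms 3 e"
  shows "degree (pull_back u p) \<le> e"
  unfolding pull_back_def const1.subst_def
proof (rule degree_sum_le)
  fix m assume m: "m \<in> Poly_Mapping.keys p"
  let ?a = "Poly_Mapping.lookup m 0" and ?b = "Poly_Mapping.lookup m 1"
  have "degree ([:0, u:] ^ ?a * [:- u, - 1:] ^ ?b) \<le> 1 * ?a + 1 * ?b"
    by (intro degree_mult_le[THEN le_trans] add_mono degree_power_le[THEN le_trans] mult_right_mono) auto
  then have "degree ([:0, u:] ^ ?a * [:- u, - 1:] ^ ?b) \<le> e"
    using ternary_monomial(2)[OF assms m] by simp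
  moreover have "eval_monomial (root_pair u) m = [:0, u:] ^ ?a * [:- u, - 1:] ^ ?b"
    unfolding ternary_monomial(1)[OF assms m] by (simp add: root_pair_def)
  ultimately show "degree ([:Poly_Mapping.lookup p m:] * eval_monomial (root_pair u) m) \<le> e"
    by (metis degree_pCons_0 degree_mult_le le_trans add_0)
qed simp

lemma pull_back_symmetric: "poly (pull_back u p) s = poly (pull_back s p) u"
proof -
  have "poly (root_pair u i) s = poly (root_pair s i) u" for i
    by (simp add: root_pair_def)
  then show ?thesis
    by (simp add: pull_back_def const1.subst_def eval_monomial_def poly_sum poly_prod)
qed

text \<open>The coefficient vectors \<open>(1, j, j^2)\<close> are Vandermonde rows, so no three of
  the lines are concurrent.\<close>

definition node_line :: "nat \<Rightarrow> real_mpoly" where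
  "node_line j = Poly_Mapping.single (Poly_Mapping.single 0 1) 1
    + Poly_Mapping.single (Poly_Mapping.single 1 1) (real j)
    + Poly_Mapping.single (Poly_Mapping.single 2 1) ((real j)\<^sup>2)"

lemma node_line_form: "node_line j \<in> forms 3 1"
  unfolding node_line_def by (intro forms_add forms_single) auto

lemma pull_back_node_line: "pull_back u (node_line j) = smult (u - real j) [:- real j, 1:]"
  by (simp add: pull_back_def node_line_def const1.subst_add root_pair_def
      power2_eq_square algebra_simps)

definition star_form :: "nat \<Rightarrow> nat \<Rightarrow> real_mpoly" where
  "star_form d i = (\<Prod>j\<in>{..d} - {i}. node_line j)"

lemma star_form_form: "i \<le> d \<Longrightarrow> star_form d i \<in> forms 3 d"
  using forms_prod[of "{..d} - {i}" node_line 3] node_line_form by (simp add: star_form_def)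

lemma pull_back_star_form:
  "pull_back u (star_form d i) = smult (poly (node_poly d i) u) (node_poly d i)"
proof -
  have "pull_back u (star_form d i) = (\<Prod>j\<in>{..d} - {i}. smult (u - real j) [:- real j, 1:])"
    unfolding star_form_def pull_back_node_line[symmetric] by (simp add: pull_back_def const1.subst_prod)
  then show ?thesis by (simp add: prod_smult node_poly_def poly_prod del: smult_pCons)
qed

lemma star_sum_length_ge:
  fixes p :: "nat \<Rightarrow> real_mpoly"
  assumes p: "\<forall>k<r. p k \<in> forms 3 d" and eq: "(\<Sum>i\<le>d. (star_form d i)\<^sup>2) = (\<Sum>k<r. (p k)\<^sup>2)"
  shows "d + 1 \<le> r"
proof -
  let ?N = "node_poly d"
  define F where "F u k = pull_back u (p k)" for u k
  have sum_F: "(\<Sum>k<r. (poly (F u k) s)\<^sup>2) = (\<Sum>i\<le>d. (poly (?N i) u * poly (?N i) s)\<^sup>2)" for u s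
  proof -
    have "(\<Sum>k<r. (F u k)\<^sup>2) = (\<Sum>i\<le>d. (pull_back u (star_form d i))\<^sup>2)"
      using arg_cong[OF eq, of "pull_back u"]
      by (simp add: F_def pull_back_def const1.subst_sum const1.subst_power2 del: sum.atMost_Suc)
    from arg_cong[OF this, of "\<lambda>P. poly P s"] show ?thesis
      by (simp add: poly_sum pull_back_star_form)
  qed
  \<comment> \<open>The parameters \<open>(i, j)\<close> give the intersection of lines
    \<open>i\<close> and \<open>j\<close>, where every star form vanishes and hence every summand
    does.\<close>
  have grid: "poly (F (real i) k) (real j) = 0" if "k < r" "i \<le> d" "j \<le> d" "i \<noteq> j" for i j k
  proof -
    have "(\<Sum>k<r. (poly (F (real i) k) (real j))\<^sup>2) = 0"
      unfolding sum_F using that by (intro sum.neutral) (auto simp: poly_node_poly_eq_0_iff)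
    then show ?thesis using that by (simp add: sum_nonneg_eq_0_iff)
  qed
  \<comment> \<open>At the parameters \<open>(j, j)\<close> only star form \<open>j\<close>
    survives, with value \<open>(poly (?N j) (real j))\<^sup>2\<close>; this determines its
    coefficient in \<open>p k\<close>.\<close>
  define b where "b k j = poly (F (real j) k) (real j) / (poly (?N j) (real j))\<^sup>2" for k j
  have deg: "degree (F u k) \<le> d" if "k < r" for u k
    using p that by (simp add: F_def degree_pull_back)
  have F_grid: "poly (F (real j) k) u = b k j * poly (?N j) (real j) * poly (?N j) u"
    if "k < r" "j \<le> d" for j k u
  proof -
    have "F (real j) k = (\<Sum>i\<le>d. if i = j then smult (b k j * poly (?N j) (real j)) (?N j) else 0)"
      by (subst node_interpolation[OF deg[OF \<open>k < r\<close>]], rule sum.cong)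
        (use that in \<open>auto simp: grid b_def power2_eq_square\<close>)
    then show ?thesis using that by simp
  qed
  \<comment> \<open>Interpolation in \<open>s\<close> followed by the symmetry in \<open>u\<close>
    and \<open>s\<close> reduces \<open>F u k\<close> to its values along the node lines, given by
    \<open>F_grid\<close>.\<close>
  have F: "poly (F u k) s = (\<Sum>j\<le>d. b k j * poly (?N j) u * poly (?N j) s)" if "k < r" for u s k
  proof -
    have sym: "poly (F u k) (real j) = poly (F (real j) k) u" for j
      unfolding F_def by (rule pull_back_symmetric)
    have "poly (F u k) s = (\<Sum>j\<le>d. poly (F u k) (real j) / poly (?N j) (real j) * poly (?N j) s)"
      by (subst node_interpolation[OF deg[OF that, of u]]) (simp add: poly_sum)
    also have "\<dots> = (\<Sum>j\<le>d. b k j * poly (?N j) u * poly (?N j) s)"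
      by (rule sum.cong) (use that in \<open>auto simp: sym F_grid poly_node_poly_eq_0_iff\<close>)
    finally show ?thesis .
  qed
  \<comment> \<open>The difference of two Gram matrices of the same form in the star forms: that of
    the given representation and the identity.\<close>
  define g where "g i j = (\<Sum>k<r. b k i * b k j) - (if i = j then 1 else 0)" for i j
  have "g i j = 0" if "i \<le> d" "j \<le> d" for i j
  proof (rule node_products_independent[OF _ _ that])
    show "g i j = g j i" for i j by (auto simp: g_def mult.commute)
    fix u s
    let ?M = "\<lambda>i. poly (?N i) u * poly (?N i) s"
    have "(\<Sum>i\<le>d. \<Sum>j\<le>d. (\<Sum>k<r. b k i * b k j) * (?M i * ?M j)) = (\<Sum>k<r. (poly (F u k) s)\<^sup>2)"
    proof -
      have "(\<Sum>k<r. (poly (F u k) s)\<^sup>2) = (\<Sum>k<r. (\<Sum>j\<le>d. b k j * ?M j)\<^sup>2)"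
        by (rule sum.cong) (auto simp: F mult.assoc)
      also have "\<dots> = (\<Sum>k<r. \<Sum>i\<le>d. \<Sum>j\<le>d. b k i * b k j * (?M i * ?M j))"
        unfolding power2_eq_square sum_product by (simp add: mult_ac)
      also have "\<dots> = (\<Sum>i\<le>d. \<Sum>k<r. \<Sum>j\<le>d. b k i * b k j * (?M i * ?M j))"
        by (rule sum.swap)
      also have "\<dots> = (\<Sum>i\<le>d. \<Sum>j\<le>d. \<Sum>k<r. b k i * b k j * (?M i * ?M j))"
        by (intro sum.cong refl sum.swap)
      finally show ?thesis unfolding sum_distrib_right ..
    qed
    moreover have "(\<Sum>i\<le>d. \<Sum>j\<le>d. (if i = j then 1 else 0) * (?M i * ?M j)) = (\<Sum>i\<le>d. (?M i)\<^sup>2)"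
      by (rule sum.cong) (auto simp: if_distrib[of "\<lambda>t. t * _"] power2_eq_square cong: if_cong)
    ultimately have "(\<Sum>i\<le>d. \<Sum>j\<le>d. g i j * (?M i * ?M j)) = 0"
      unfolding g_def left_diff_distrib sum_subtractf using sum_F by simp
    then show "(\<Sum>i\<le>d. \<Sum>j\<le>d. g i j * poly (?N i * ?N j) u * poly (?N i * ?N j) s) = 0"
      by (simp add: mult_ac)
  qed
  then have "(\<Sum>k<r. b k i * b k j) = (if i = j then 1 else 0)" if "i < d + 1" "j < d + 1" for i j
    using that by (simp add: g_def)
  then show ?thesis by (rule orthonormal_le_dimension)
qed

theorem theorem3p6:
  fixes d :: nat
  assumes "d \<ge> 2"
  shows "pythagoras_number 3 d \<in> {enat (d + 1), enat (d + 2)}"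
proof -
  define f where "f = (\<Sum>i\<le>d. (star_form d i)\<^sup>2)"
  have "is_sum_of_squares 3 d (d + 1) f"
    unfolding is_sum_of_squares_def f_def
    by (intro exI[of _ "star_form d"]) (auto simp: star_form_form lessThan_Suc_atMost)
  moreover have "f \<in> forms 3 (2 * d)"
    unfolding f_def by (intro forms_sum forms_power2 star_form_form) simp
  ultimately have f: "f \<in> sos_forms 3 d" and "is_sum_of_squares 3 d (sos_length 3 d f) f"
    unfolding sos_forms_def sos_length_def by (auto intro: LeastI)
  then have "d + 1 \<le> sos_length 3 d f"
    unfolding is_sum_of_squares_def f_def using star_sum_length_ge by blast
  then have "enat (d + 1) \<le> pythagoras_number 3 d"
    unfolding pythagoras_number_def by (intro SUP_upper2[OF f]) simp
  moreover have "pythagoras_number 3 d \<le> enat (d + 2)"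
    unfolding pythagoras_number_def
  proof (rule SUP_least)
    fix f assume "f \<in> sos_forms 3 d"
    then have "is_sum_of_squares 3 d (d + 2) f"
      using ternary_sos_length_le unfolding sos_forms_def is_sum_of_squares_def by blast
    then show "enat (sos_length 3 d f) \<le> enat (d + 2)"
      unfolding sos_length_def by (simp add: Least_le)
  qed
  ultimately show ?thesis
    by (cases "pythagoras_number 3 d") auto
qed

end
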